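(* Let $\zeta(s)$ denote the Riemann zeta-function and write $s = \sigma + it$ with $\sigma, t$ real. For every $s$ with $\sigma > \tfrac{1}{2}$ and $|t| \geq 6.29073$ such that $\zeta(s) \neq 0$, one has $|\zeta(1-s)| > |\zeta(s)|$. *)

theory Defs
  imports "HOL-Complex_Analysis.Complex_Analysis"
begin

text \<open>
  The Riemann zeta function is the analytic continuation of
  \<open>1\<^sup>-\<^sup>s + 2\<^sup>-\<^sup>s + 3\<^sup>-\<^sup>s + \<dots>\<close> (for \<open>Re s > 1\<close>) to the complex plane without the
  simple pole at 1. As functions are total, the value at the pole is fixed to be 0.
\<close>

definition is_zeta :: "(complex \<Rightarrow> complex) \<Rightarrow> bool" where
  "is_zeta f \<longleftrightarrow>
     f holomorphic_on (- {1}) \<and>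
     (\<forall>s. Re s > 1 \<longrightarrow> (\<lambda>n. of_nat (Suc n) powr (- s)) sums f s) \<and>
     f 1 = 0"

definition riemann_zeta :: "complex \<Rightarrow> complex" where
  "riemann_zeta = (THE f. is_zeta f)"

lemma is_zeta_unique:
  assumes f: "is_zeta f" and g: "is_zeta g"
  shows "f = g"
proof
  fix s :: complex
  show "f s = g s"
  proof (cases "s = 1")
    case True
    then show ?thesis using f g by (simp add: is_zeta_def)
  next
    case False
    show ?thesis
    proof (rule analytic_continuation_open[where f = f and g = g])
      show "open {z. 1 < Re z}" by (rule open_halfspace_Re_gt)
      show "{z. 1 < Re z} \<noteq> {}" by (auto intro: exI[of _ 2])
      show "connected (- {1 :: complex})"
        by (rule connected_punctured_universe) simp
      show "f z = g z" if "z \<in> {z. 1 < Re z}" for z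
        using that f g sums_unique2 unfolding is_zeta_def by blast
    qed (use f g False in \<open>auto simp: is_zeta_def\<close>)
  qed
qed

end

theory Submission
  imports Defs "HOL-Real_Asymp.Real_Asymp"
begin

text \<open>
  The functional equation \<open>\<zeta>(1-s) = \<chi>(s) \<zeta>(s)\<close> with
  \<open>\<chi>(s) = 2 (2\<pi>)\<^sup>-\<^sup>s cos(\<pi>s/2) \<Gamma>(s)\<close> reduces the claim to \<open>\<bar>\<chi>(s)\<bar> > 1\<close>.

  Summing the errors of the trapezoid rule for \<open>x\<^sup>-\<^sup>s\<close> over the intervals \<open>[n, n+1]\<close> continues
  \<open>\<zeta>\<close> to \<open>Re s > -1\<close>. For real \<open>s\<close> between \<open>-1\<close> and \<open>0\<close>, writing \<open>\<Gamma>(s+2) x\<^sup>-\<^sup>s\<^sup>-\<^sup>2\<close> as a Gamma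
  integral turns \<open>\<Gamma>(s) \<zeta>(s)\<close> into the integral over \<open>u > 0\<close> of \<open>u\<^sup>s\<^sup>-\<^sup>1\<close> times
  \<open>1/(e\<^sup>u-1) - 1/u + 1/2\<close>. All integrands are nonnegative, so expanding the latter function in
  partial fractions \<open>2u/(u\<^sup>2+4\<pi>\<^sup>2k\<^sup>2)\<close> and integrating termwise is allowed and gives
  \<open>\<zeta>(1-s)\<close>. The identity theorem extends the equation to the strip \<open>-1 < Re s < 2\<close>, and the
  equation itself then defines \<open>\<zeta>\<close> on the remaining half-plane.

  On the critical line \<open>\<bar>\<chi>(s)\<bar> = 1\<close>, and \<open>ln \<bar>\<chi>(\<sigma>+it)\<bar>\<close> increases with \<open>\<sigma>\<close> because
  \<open>Re \<psi>(s) > ln(2\<pi>)\<close> by a small margin. At \<open>s = 1/2 + it\<close> one has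
  \<open>Re \<psi>(s) = ln t - 1/(24 t\<^sup>2) + \<dots>\<close>, which exceeds \<open>ln(2\<pi>)\<close> from about \<open>t = 6.28984\<close> on.
  The bound on \<open>Re \<psi>\<close> is obtained by comparing \<open>Re 1/(s+k)\<close> termwise with the increments of
  this expansion.
\<close>

section \<open>The size of the factor in the functional equation\<close>

text \<open>Keeps two terms of the odd power series of \<open>2 * artanh y\<close>. The difference
  of the two sides vanishes at 0 and has derivative \<open>2 * z^4 / (1 - z^2)\<close>.\<close>

lemma ln_ratio_ge:
  fixes y :: real
  assumes "0 \<le> y" "y < 1"
  shows "2 * y + 2 * y ^ 3 / 3 \<le> ln (1 + y) - ln (1 - y)"
proof -
  define g where "g = (\<lambda>y::real. ln (1 + y) - ln (1 - y) - (2 * y + 2 * y ^ 3 / 3))"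
  have "g 0 \<le> g y"
  proof (rule DERIV_nonneg_imp_nondecreasing[OF assms(1)])
    fix z assume z: "0 \<le> z" "z \<le> y"
    have z1: "z < 1" using z assms by linarith
    have "z * z < 1 * 1" using z z1 by (intro mult_strict_mono') auto
    hence z2: "z ^ 2 < 1" by (simp add: power2_eq_square)
    have "(g has_real_derivative 1 / (1 + z) + 1 / (1 - z) - (2 + 2 * z ^ 2)) (at z)"
      unfolding g_def using z z1 by (auto intro!: derivative_eq_intros simp: power2_eq_square)
    moreover have "1 / (1 + z) + 1 / (1 - z) - (2 + 2 * z ^ 2) = 2 * z ^ 4 / (1 - z ^ 2)"
      using z z1 z2 by (simp add: divide_simps) (simp add: algebra_simps power2_eq_square power4_eq_xxxx)
    moreover have "2 * z ^ 4 / (1 - z ^ 2) \<ge> 0" using z2 by simp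
    ultimately show "\<exists>d. (g has_real_derivative d) (at z) \<and> d \<ge> 0" by metis
  qed
  thus ?thesis by (simp add: g_def)
qed

text \<open>
  Numerator of the difference of the two sides in \<open>stirling_re_step\<close>, with
  \<open>q = x\<^sup>2 + T + 1/4\<close> and \<open>E = q\<^sup>2 - x\<^sup>2\<close>. Expanded in \<open>a = q - T - 1/2\<close> and
  \<open>b = T - 39\<close>, all its coefficients are positive.
\<close>
lemma stirling_increment_numerator_nonneg:
  fixes q T E :: real
  assumes "T \<ge> 39" "q \<ge> T + 1/2" and E: "E = q^2 - q + T + 1/4"
  shows "0 \<le> q^3 * (q - 1/4) * ((4 * T + 24/5) * q - E) - E^2 * (2 * q - q^2 + 4 * T * q - 1/4 - T)"
proof -
  define a b where "a = q - T - 1/2" and "b = T - 39"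
  have ab: "a \<ge> 0" "b \<ge> 0" using assms by (auto simp: a_def b_def)
  have T: "T = 39 + b" and q: "q = 79/2 + a + b" by (auto simp: a_def b_def)
  have "q^3 * (q - 1/4) * ((4 * T + 24/5) * q - E) - E^2 * (2 * q - q^2 + 4 * T * q - 1/4 - T) =
      (23615574417/80) + (5971019801/160) * b + (301941387/160) * b^2 + (3817077/80) * b^3 +
      (24127/40) * b^4 + (61/20) * b^5 + (4327748523/80) * a + (54799719/10) * a * b +
      (16653341/80) * a * b^2 + (70289/20) * a * b^3 + (89/4) * a * b^4 +
      (495737077/160) * a^2 + (18853691/80) * a^2 * b + (59753/10) * a^2 * b^2 +
      (101/2) * a^2 * b^3 + (6029987/80) * a^3 + (76479/20) * a^3 * b + (97/2) * a^3 * b^2 +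
      (30397/40) * a^4 + (77/4) * a^4 * b + (41/20) * a^5"
    unfolding E T q by algebra
  also have "\<dots> \<ge> 0" using ab by simp
  finally show ?thesis .
qed

text \<open>
  For \<open>T = t\<^sup>2\<close> this is \<open>Re (ln w + 1 / (24 w\<^sup>2))\<close> at \<open>w = y + \<i>t\<close>, the start of the
  expansion of \<open>Re \<psi>(1/2 + w)\<close>, less \<open>1 / (10 \<bar>w\<bar>\<^sup>4)\<close> as slack for the remainder.
\<close>
definition stirling_re :: "real \<Rightarrow> real \<Rightarrow> real" where
  "stirling_re T y = ln (y^2 + T) / 2 + 1 / (24 * (y^2 + T)) - (T / 12 + 1 / 10) / (y^2 + T)^2"

text \<open>For \<open>T = t^2\<close> the left side is the real part of
  \<open>1 / (x + i*t)\<close>, one term of the digamma series, set against the increment over the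
  unit interval centred at \<open>x\<close>. Once \<open>ln_ratio_ge\<close> has replaced the
  logarithms by a rational function, the polynomial inequality above remains.\<close>

lemma stirling_re_step:
  fixes x T :: real
  assumes T: "T \<ge> 39" and x: "x \<ge> 1/2"
  shows "x / (x^2 + T) \<le> stirling_re T (x + 1/2) - stirling_re T (x - 1/2)"
proof -
  \<comment> \<open>\<open>q\<close> is the midpoint of the two values
    \<open>(x + 1/2)^2 + T = q + x\<close> and \<open>(x - 1/2)^2 + T = q - x\<close>, and
    \<open>E\<close> is their product.\<close>
  define q where "q = x^2 + T + 1/4"
  define E where "E = q^2 - x^2"
  define K where "K = T / 12 + 1 / 10"
  have "(1/2)^2 \<le> x^2" using x by (intro power_mono) auto
  hence q1: "q \<ge> T + 1/2" by (simp add: q_def power2_eq_square)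
  have "0 \<le> (x - 1/2)^2" by simp
  hence qx: "q \<ge> x + 39" using T by (simp add: q_def power2_eq_square algebra_simps)
  have q0: "q > 1" using q1 T by simp
  have E_fact: "E = (q + x) * (q - x)" by (simp add: E_def power2_eq_square algebra_simps)
  have E0: "E > 0" unfolding E_fact using qx x by (intro mult_pos_pos) auto
  have plus: "(x + 1/2)^2 + T = q + x" "(x - 1/2)^2 + T = q - x" "x^2 + T = q - 1/4"
    by (simp_all add: q_def power2_eq_square algebra_simps)
  have y: "0 \<le> x / q" "x / q < 1" using x qx q0 by auto
  have "ln (q + x) - ln (q - x) = ln (1 + x / q) - ln (1 - x / q)"
  proof -
    have "q + x = q * (1 + x / q)" "q - x = q * (1 - x / q)" using q0 by (auto simp: field_simps)
    moreover have "ln (q * (1 + x / q)) = ln q + ln (1 + x / q)"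
      using y q0 by (intro ln_mult_pos) auto
    moreover have "ln (q * (1 - x / q)) = ln q + ln (1 - x / q)"
      using y q0 by (intro ln_mult_pos) auto
    ultimately show ?thesis by (metis add_diff_cancel_left)
  qed
  with ln_ratio_ge[OF y] have ln: "(ln (q + x) - ln (q - x)) / 2 \<ge> x / q + (x / q)^3 / 3" by simp
  have "0 \<le> q^3 * (q - 1/4) * ((4 * T + 24/5) * q - E) - E^2 * (2 * q - q^2 + 4 * T * q - 1/4 - T)"
    by (rule stirling_increment_numerator_nonneg) (use T q1 in \<open>auto simp: E_def q_def\<close>)
  \<comment> \<open>Uses \<open>48 * K = 4 * T + 24/5\<close> and
    \<open>x^2 = q - T - 1/4\<close>.\<close>
  also have "\<dots> = q^3 * (q - 1/4) * (48 * K * q - E) - E^2 * (3 * q^2 - 4 * x^2 * (q - 1/4))"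
    unfolding K_def q_def by (simp add: field_simps power2_eq_square power3_eq_cube)
  finally have "0 \<le> x * (\<dots> / (12 * q^3 * (q - 1/4) * E^2))" using x q0 by simp
  also have "\<dots> = x * ((4 * K * q / E^2 - 1 / (12 * E)) - (1 / (4 * q * (q - 1/4)) - x^2 / (3 * q^3)))"
  proof -
    have "q \<noteq> 0" "4 * q \<noteq> 1" "E \<noteq> 0" using q0 E0 by auto
    thus ?thesis
      by (simp add: divide_simps) (simp add: algebra_simps power2_eq_square power3_eq_cube)
  qed
  also have "\<dots> = (1 / (24 * (q + x)) - K / (q + x)^2) - (1 / (24 * (q - x)) - K / (q - x)^2)
                 - (x / (q - 1/4) - x / q - (x / q)^3 / 3)"
  proof -
    have nz: "q \<noteq> 0" "q - 1/4 \<noteq> 0" "q + x \<noteq> 0" "q - x \<noteq> 0" using q0 x qx by auto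
    have "x * (1 / (4 * q * (q - 1/4)) - x^2 / (3 * q^3)) = x / (q - 1/4) - x / q - (x / q)^3 / 3"
      using q0 nz by (simp add: divide_simps) (simp add: algebra_simps power2_eq_square power3_eq_cube)
    moreover have "x * (4 * K * q / E^2 - 1 / (12 * E)) = (1 / (24 * (q + x)) - K / (q + x)^2) - (1 / (24 * (q - x)) - K / (q - x)^2)"
      unfolding E_fact using nz
      by (simp add: divide_simps) (simp add: algebra_simps power2_eq_square power3_eq_cube)
    ultimately show ?thesis by (simp add: algebra_simps)
  qed
  finally show ?thesis using ln unfolding stirling_re_def plus K_def by argo
qed

text \<open>\<open>Digamma z\<close> is the limit of \<open>ln m\<close> minus the partial sums of
  \<open>1 / (z + k)\<close>. By \<open>stirling_re_step\<close> at \<open>x = d + k + 1/2\<close>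
  the real parts of these sums are bounded by a telescoping sum, and
  \<open>stirling_re (t^2) (d + m)\<close> differs from \<open>ln m\<close> by a null
  sequence.\<close>

lemma Re_Digamma_ge:
  fixes t d :: real
  assumes T: "t^2 \<ge> 39" and d: "d \<ge> 0"
  shows "Re (Digamma (Complex (1/2 + d) t)) \<ge> stirling_re (t^2) d"
proof -
  define r where "r = stirling_re (t^2)"
  define z where "z = Complex (1/2 + d) t"
  have z0: "z \<noteq> 0" using d by (auto simp: z_def complex_eq_iff)
  have lim: "(\<lambda>m. ln (real m) - (\<Sum>k<m. Re (inverse (z + of_nat k)))) \<longlonglongrightarrow> Re (Digamma z)"
    using tendsto_Re[OF Digamma_LIMSEQ[OF z0]] by simp
  have step: "Re (inverse (z + of_nat k)) \<le> r (d + real (Suc k)) - r (d + real k)" for k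
  proof -
    have "Re (inverse (z + of_nat k)) = (d + k + 1/2) / ((d + k + 1/2)^2 + t^2)"
      by (simp add: z_def algebra_simps)
    also have "\<dots> \<le> r (d + k + 1/2 + 1/2) - r (d + k + 1/2 - 1/2)"
      unfolding r_def using T d by (intro stirling_re_step) auto
    finally show ?thesis by (simp add: add_ac)
  qed
  have "(\<Sum>k<m. Re (inverse (z + of_nat k))) \<le> r (d + m) - r d" for m
  proof -
    have "(\<Sum>k<m. Re (inverse (z + of_nat k))) \<le> (\<Sum>k<m. r (d + real (Suc k)) - r (d + real k))"
      by (intro sum_mono step)
    also have "\<dots> = r (d + m) - r d" by (subst sum_lessThan_telescope) simp
    finally show ?thesis .
  qed
  hence ev: "ln (real m) - r (d + m) + r d \<le> ln (real m) - (\<Sum>k<m. Re (inverse (z + of_nat k)))" for m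
    by (smt (verit))
  have "(\<lambda>m. ln (real m) - r (d + m) + r d) \<longlonglongrightarrow> 0 + r d"
  proof (intro tendsto_add tendsto_const)
    have "t^2 > 0" using T by linarith
    define T' where "T' = t^2"
    have "T' > 0" unfolding T'_def by fact
    show "(\<lambda>m. ln (real m) - r (d + m)) \<longlonglongrightarrow> 0"
      unfolding r_def stirling_re_def T'_def[symmetric] using \<open>T' > 0\<close> by real_asymp
  qed
  from LIMSEQ_le[OF this lim] ev show ?thesis by (auto simp: r_def z_def)
qed

text \<open>The value is at least \<open>ln P / 2 - (1/24 + 1/390) / P\<close>, which increases with
  \<open>P\<close>, so the case \<open>P = Q\<close> decides. There \<open>(2 * pi)^2 / Q\<close> is
  so close to 1 that \<open>ln x \<le> x - 1\<close> is sharp enough. The surplus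
  \<open>1 / 20000\<close> later absorbs the sine term in the derivative of
  \<open>chi_log\<close>.\<close>

lemma stirling_re_gt:
  fixes T d :: real
  assumes T: "T \<ge> 6.29073^2" and d: "d \<ge> 0"
  shows "stirling_re T d > ln (2 * pi) + 1 / 20000"
proof -
  define P where "P = d^2 + T"
  define Q where "Q = (6.29073::real)^2"
  have P: "P \<ge> T" "P \<ge> Q" "P > 0" "Q > 0"
  proof -
    show "Q > 0" by (simp add: Q_def)
    moreover have "Q \<le> T" using T by (simp add: Q_def)
    ultimately show "P \<ge> T" "P \<ge> Q" "P > 0" by (auto simp: P_def intro: add_increasing add_nonneg_pos)
  qed
  have Q39: "Q \<ge> 39" by (simp add: Q_def power2_eq_square)
  have "(2 * pi)^2 \<le> (2 * 3.1415926535899)^2" using pi_approx(2) by (intro power_mono) auto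
  hence "(2 * pi)^2 / Q \<le> (2 * 3.1415926535899)^2 / Q" using P by (intro divide_right_mono) auto
  also have "\<dots> < 1 - 2 * (1/24 + 1/390) / Q - 1/10000" by (simp add: Q_def power2_eq_square)
  finally have num: "(2 * pi)^2 / Q < 1 - 2 * (1/24 + 1/390) / Q - 1/10000" .
  have "ln ((2 * pi)^2 / Q) \<le> (2 * pi)^2 / Q - 1" using P by (intro ln_le_minus_one) auto
  moreover have "ln ((2 * pi)^2 / Q) = 2 * ln (2 * pi) - ln Q"
    using P ln_realpow[of "2 * pi" 2] by (subst ln_div) auto
  ultimately have "ln Q - 2 * ln (2 * pi) \<ge> 1 - (2 * pi)^2 / Q" by linarith
  with num have "ln (2 * pi) + 1/20000 < ln Q / 2 - (1/24 + 1/390) / Q" by linarith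
  also have "\<dots> \<le> ln P / 2 - (1/24 + 1/390) / P"
    using P by (intro diff_mono divide_left_mono divide_right_mono ln_mono) auto
  also have "\<dots> \<le> ln P / 2 + 1 / (24 * P) - (T / 12 + 1 / 10) / P^2"
  proof -
    \<comment> \<open>\<open>T \<le> P\<close> handles the first summand, and
      \<open>P \<ge> 39\<close> gives \<open>1/10 \<le> P / 390\<close>.\<close>
    have "T / 12 + 1/10 \<le> (1/12 + 1/390) * P" using P Q39 by (simp add: field_simps)
    hence "(T / 12 + 1/10) / P^2 \<le> (1/12 + 1/390) * P / P^2" by (intro divide_right_mono) auto
    also have "\<dots> = (1/12 + 1/390) / P" using P by (simp add: power2_eq_square)
    also have "\<dots> = 1 / (24 * P) + (1/24 + 1/390) / P" by (simp add: field_simps)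
    finally show ?thesis by linarith
  qed
  finally show ?thesis by (simp add: stirling_re_def P_def)
qed

section \<open>Modulus of \<open>chi_factor\<close> on and to the right of the critical line\<close>

lemma norm_cos_complex_sq: "norm (cos (Complex x y))^2 = (cosh (2 * y) + cos (2 * x)) / 2"
proof -
  have "norm (cos (Complex x y))^2 = (cos x * cosh y)^2 + (sin x * sinh y)^2"
    unfolding cmod_power2 by (simp add: Re_cos Im_cos cosh_def sinh_def power2_eq_square field_simps)
  also have "\<dots> = cos x ^ 2 * cosh y ^ 2 + (1 - cos x ^ 2) * (cosh y ^ 2 - 1)"
    by (simp add: power_mult_distrib sin_squared_eq sinh_square_eq)
  also have "\<dots> = cosh y ^ 2 + cos x ^ 2 - 1" by (simp add: algebra_simps)
  also have "\<dots> = (cosh (2 * y) + cos (2 * x)) / 2"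
    by (simp add: cosh_double_cosh cos_double_cos)
  finally show ?thesis .
qed

text \<open>On the critical line \<open>1 - z\<close> is the conjugate of \<open>z\<close>, so the
  reflection formula evaluates \<open>Gamma z * cnj (Gamma z)\<close>.\<close>

lemma norm_Gamma_half_sq: "norm (Gamma (Complex (1/2) t))^2 = pi / cosh (pi * t)"
proof -
  define z where "z = Complex (1/2) t"
  have "1 - z = cnj z" by (simp add: z_def complex_eq_iff)
  hence "Gamma z * cnj (Gamma z) = of_real pi / sin (of_real pi * z)"
    using Gamma_reflection_complex[of z] by (simp add: cnj_Gamma)
  hence "norm (Gamma z) ^ 2 = pi / norm (sin (of_real pi * z))"
    by (metis norm_mult complex_mod_cnj norm_divide norm_of_real power2_eq_square abs_of_pos pi_gt_zero)
  also have "sin (of_real pi * z) = of_real (cosh (pi * t))"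
    by (simp add: z_def complex_eq_iff Re_sin Im_sin cosh_def)
  finally show ?thesis by (simp add: z_def)
qed

definition chi_factor :: "complex \<Rightarrow> complex" where
  "chi_factor s = 2 * of_real (2 * pi) powr (-s) * cos (of_real pi * s / 2) * Gamma s"

text \<open>For \<open>t > 0\<close> this equals
  \<open>ln (norm (chi_factor (Complex x t))) - ln 2 / 2\<close>; the last summand comes from
  \<open>norm_cos_complex_sq\<close>.\<close>

definition chi_log :: "real \<Rightarrow> real \<Rightarrow> real" where
  "chi_log t x = Re (ln_Gamma (Complex x t)) - x * ln (2 * pi) + ln (cosh (pi * t) + cos (pi * x)) / 2"

text \<open>The derivative is \<open>Re (Digamma (Complex y t)) - ln (2 * pi) - pi * sin (pi * y) /
  (2 * D)\<close>. The first two terms leave more than \<open>1/20000\<close>, while the third is at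
  most \<open>2/131071\<close> because \<open>D\<close> is exponentially large in
  \<open>t\<close>.\<close>

lemma chi_log_strict_mono:
  assumes t: "t \<ge> 6.29073" and x: "x > 1/2"
  shows "chi_log t (1/2) < chi_log t x"
proof (rule DERIV_pos_imp_increasing[OF x])
  fix y assume y: "1/2 \<le> y" "y \<le> x"
  define D where "D = cosh (pi * t) + cos (pi * y)"
  have t2: "t^2 \<ge> 6.29073^2" using t by (intro power_mono) auto
  have t39: "t^2 \<ge> 39" using t2 by (simp add: power2_eq_square)
  \<comment> \<open>\<open>pi * t \<ge> 18\<close> and \<open>exp 1 \<ge> 2\<close> give
    \<open>exp (pi * t) \<ge> 2^18\<close>, hence \<open>cosh (pi * t) \<ge> 2^17 = 131072\<close>;
    the cosine costs at most 1.\<close>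
  have D: "D \<ge> 131071"
  proof -
    have "18 \<le> 3 * t" using t by simp
    also have "3 * t \<le> pi * t" using t pi_approx(1) by (intro mult_right_mono) auto
    finally have "exp (18::real) \<le> exp (pi * t)" by simp
    moreover have "(2::real)^18 \<le> exp 1 ^ 18"
      using exp_ge_add_one_self[of "1::real"] by (intro power_mono) auto
    hence "(2::real)^18 \<le> exp 18" by (simp add: exp_of_nat_mult[symmetric])
    ultimately have "2 ^ 18 \<le> exp (pi * t)" by linarith
    hence "262144 \<le> exp (pi * t)" by simp
    hence "cosh (pi * t) \<ge> 131072"
      using exp_gt_zero[of "- (pi * t)"] by (simp add: cosh_field_def del: exp_gt_zero)
    thus ?thesis using cos_ge_minus_one[of "pi * y"] unfolding D_def by linarith
  qed
  have z: "Complex y t \<notin> \<real>\<^sub>\<le>\<^sub>0" using t by (auto simp: complex_nonpos_Reals_iff)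
  have "((\<lambda>w. ln_Gamma (w + \<i> * of_real t)) has_field_derivative Digamma (Complex y t)) (at (of_real y))"
    using z by (auto intro!: derivative_eq_intros simp: Complex_eq)
  hence "((\<lambda>y. ln_Gamma (of_real y + \<i> * of_real t)) has_vector_derivative Digamma (Complex y t)) (at y)"
    by (rule has_vector_derivative_real_field)
  hence "((\<lambda>y. ln_Gamma (Complex y t)) has_vector_derivative Digamma (Complex y t)) (at y)"
    by (simp add: Complex_eq)
  hence G: "((\<lambda>y. Re (ln_Gamma (Complex y t))) has_real_derivative Re (Digamma (Complex y t))) (at y)"
    unfolding has_real_derivative_iff_has_vector_derivative
    by (rule bounded_linear.has_vector_derivative[OF bounded_linear_Re])
  have "((\<lambda>y. ln (cosh (pi * t) + cos (pi * y)) / 2 - y * ln (2 * pi)) has_real_derivative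
      - pi * sin (pi * y) / (2 * D) - ln (2 * pi)) (at y)"
    using D by (auto intro!: derivative_eq_intros simp: D_def field_simps)
  from DERIV_add[OF G this] have deriv: "(chi_log t has_real_derivative
     Re (Digamma (Complex y t)) - ln (2 * pi) - pi * sin (pi * y) / (2 * D)) (at y)"
    by (simp add: chi_log_def[abs_def] algebra_simps)
  have "stirling_re (t^2) (y - 1/2) > ln (2 * pi) + 1 / 20000"
    using t2 y by (intro stirling_re_gt) auto
  moreover have "stirling_re (t^2) (y - 1/2) \<le> Re (Digamma (Complex (1/2 + (y - 1/2)) t))"
    using t39 y by (intro Re_Digamma_ge) auto
  ultimately have "Re (Digamma (Complex y t)) > ln (2 * pi) + 1/20000" by simp
  moreover have "pi * sin (pi * y) / (2 * D) \<le> 4 * 1 / (2 * 131071)"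
  proof -
    have "pi * sin (pi * y) \<le> pi * 1" by (intro mult_left_mono) auto
    also have "\<dots> \<le> 4 * 1" using pi_approx(2) by simp
    finally show ?thesis using D by (intro frac_le) auto
  qed
  ultimately show "\<exists>d. (chi_log t has_real_derivative d) (at y) \<and> 0 < d"
    by (intro exI[of _ "Re (Digamma (Complex y t)) - ln (2 * pi) - pi * sin (pi * y) / (2 * D)"] conjI deriv) linarith
qed

lemma norm_chi_factor_gt_1_pos:
  fixes s :: complex
  assumes s: "Re s > 1/2" "Im s \<ge> 6.29073"
  shows "norm (chi_factor s) > 1"
proof -
  define t x where "t = Im s" and "x = Re s"
  have s_eq: "s = Complex x t" by (simp add: t_def x_def)
  have cosh_gt: "cosh (pi * t) > 1"
    using s cosh_real_ge_1[of "pi * t"] cosh_real_one_iff[of "pi * t"]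
    by (auto simp: t_def order.strict_iff_order)
  have cosh_pos: "cosh (pi * t) + cos (pi * y) > 0" for y
    using cosh_gt cos_ge_minus_one[of "pi * y"] by linarith
  have nz: "Complex y t \<notin> \<real>\<^sub>\<le>\<^sub>0" for y using s by (auto simp: complex_nonpos_Reals_iff t_def)
  have G: "Re (ln_Gamma (Complex y t)) = ln (norm (Gamma (Complex y t)))"
       "norm (Gamma (Complex y t)) > 0" for y
  proof -
    have "Complex y t \<notin> \<int>\<^sub>\<le>\<^sub>0" using nz[of y] nonpos_Ints_subset_nonpos_Reals by blast
    hence "Gamma (Complex y t) = exp (ln_Gamma (Complex y t))"
      by (simp add: Gamma_complex_altdef)
    thus "Re (ln_Gamma (Complex y t)) = ln (norm (Gamma (Complex y t)))" "norm (Gamma (Complex y t)) > 0"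
      by simp_all
  qed
  have E: "exp (2 * chi_log t y) = norm (Gamma (Complex y t))^2 * (2 * pi) powr (- 2 * y) * (cosh (pi * t) + cos (pi * y))" for y
  proof -
    have "2 * chi_log t y = ln (norm (Gamma (Complex y t))) + ln (norm (Gamma (Complex y t))) + (- 2 * y) * ln (2 * pi) + ln (cosh (pi * t) + cos (pi * y))"
      by (simp add: chi_log_def G)
    hence "exp (2 * chi_log t y) = exp (ln (norm (Gamma (Complex y t)))) * exp (ln (norm (Gamma (Complex y t)))) *
        exp ((- 2 * y) * ln (2 * pi)) * exp (ln (cosh (pi * t) + cos (pi * y)))"
      by (simp only: exp_add)
    thus ?thesis using G(2)[of y] cosh_pos[of y] by (simp add: powr_def power2_eq_square)
  qed
  \<comment> \<open>This is \<open>norm (chi_factor s) = 1\<close> on the critical line: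
    \<open>cosh\<close> cancels against \<open>norm_Gamma_half_sq\<close>,
    \<open>cos (pi / 2)\<close> is 0, and \<open>pi / (2 * pi)\<close> remains.\<close>
  have "exp (2 * chi_log t (1/2)) = 1/2"
    unfolding E norm_Gamma_half_sq using cosh_gt by (simp add: powr_minus field_simps)
  moreover have "chi_log t (1/2) < chi_log t x"
    using s by (intro chi_log_strict_mono) (auto simp: t_def x_def)
  ultimately have "1/2 < exp (2 * chi_log t x)" by (metis exp_less_mono mult_less_cancel_left_pos zero_less_numeral)
  also have "\<dots> = norm (chi_factor s) ^ 2 / 2"
  proof -
    have c: "of_real pi * s / 2 = Complex (pi * x / 2) (pi * t / 2)"
      by (simp add: s_eq complex_eq_iff)
    have p: "norm (of_real (2 * pi) powr (-s)) ^ 2 = (2 * pi) powr (- 2 * x)"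
      by (subst norm_powr_real_powr) (auto simp: powr_power x_def)
    have "norm (chi_factor s) ^ 2 =
       2^2 * norm (of_real (2 * pi) powr (-s)) ^ 2 * norm (cos (of_real pi * s / 2))^2 * norm (Gamma s)^2"
      by (simp add: chi_factor_def norm_mult power_mult_distrib)
    also have "\<dots> = 2 * exp (2 * chi_log t x)"
      unfolding p c norm_cos_complex_sq E by (simp add: s_eq mult_ac)
    finally show ?thesis by simp
  qed
  finally have "1 < norm (chi_factor s) ^ 2" by simp
  thus ?thesis by (metis norm_ge_zero one_power2 power_less_imp_less_base)
qed

text \<open>\<open>chi_factor\<close> commutes with conjugation, so reflection in the real axis
  covers negative imaginary parts.\<close>

lemma norm_chi_factor_gt_1:
  fixes s :: complex
  assumes s: "Re s > 1/2" "\<bar>Im s\<bar> \<ge> 6.29073"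
  shows "norm (chi_factor s) > 1"
proof (cases "Im s \<ge> 0")
  case True
  with s show ?thesis by (intro norm_chi_factor_gt_1_pos) auto
next
  case False
  have "norm (chi_factor (cnj s)) > 1"
    using s False by (intro norm_chi_factor_gt_1_pos) auto
  also have "norm (chi_factor (cnj s)) = norm (cnj (chi_factor s))"
    by (simp add: chi_factor_def cnj_powr cnj_cos cnj_Gamma norm_mult)
  finally show ?thesis by (simp only: complex_mod_cnj)
qed

section \<open>Continuation by the trapezoid rule\<close>

text \<open>
  The error of the trapezoid rule for \<open>x\<^sup>-\<^sup>s\<close> on \<open>[n, n+1]\<close>. As \<open>0 powr z = 0\<close>, the term for
  \<open>n = 0\<close> is \<open>1/2 + 1/(s-1)\<close>, so that the sum over all \<open>n\<close> is \<open>\<zeta>(s)\<close> itself.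
\<close>
definition zeta_trapezoid :: "nat \<Rightarrow> complex \<Rightarrow> complex" where
  "zeta_trapezoid n s = (of_nat n powr (-s) + of_nat (Suc n) powr (-s)) / 2 -
     (of_nat (Suc n) powr (1 - s) - of_nat n powr (1 - s)) / (1 - s)"

lemma holomorphic_zeta_trapezoid: "zeta_trapezoid n holomorphic_on (- {1})"
  unfolding zeta_trapezoid_def[abs_def] by (auto intro!: holomorphic_intros)

text \<open>Two integrations by parts against the Peano kernel \<open>y * (1 - y) / 2\<close> of the
  trapezoid rule. With \<open>n > 0\<close> the base \<open>n + y\<close> stays off the branch cut
  of \<open>powr\<close>.\<close>

lemma zeta_trapezoid_has_integral:
  fixes s :: complex
  assumes n: "n > 0" and s: "s \<noteq> 1"
  shows "((\<lambda>y. of_real (y * (1 - y) / 2) * (s * (s + 1)) * of_real (real n + y) powr (-s - 2))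
           has_integral zeta_trapezoid n s) {0..1}"
proof -
  define f0 where "f0 = (\<lambda>z::complex. z powr (1 - s) / (1 - s))"
  define f1 where "f1 = (\<lambda>z::complex. z powr (- s))"
  define f2 where "f2 = (\<lambda>z::complex. - s * z powr (- s - 1))"
  \<comment> \<open>The antiderivative those integrations by parts produce, with
    \<open>f0' = f1\<close> and \<open>f1' = f2\<close>.\<close>
  define G where "G = (\<lambda>y. (y * (1 - y) * f2 (of_nat n + y) - (1 - 2 * y) * f1 (of_nat n + y) - 2 * f0 (of_nat n + y)) / 2)"
  have "((\<lambda>y. of_real (y * (1 - y) / 2) * (s * (s + 1)) * of_real (real n + y) powr (-s - 2))
           has_integral G (of_real 1) - G (of_real 0)) {0..1}"
  proof (rule fundamental_theorem_of_calculus)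
    fix y :: real assume y: "y \<in> {0..1}"
    define z where "z = of_nat n + complex_of_real y"
    have z: "z \<notin> \<real>\<^sub>\<le>\<^sub>0" using n y by (auto simp: z_def complex_nonpos_Reals_iff)
    have d0: "((\<lambda>y. f0 (of_nat n + y)) has_field_derivative f1 z) (at (of_real y))"
      using z s unfolding f0_def f1_def z_def
      by (auto intro!: derivative_eq_intros has_field_derivative_powr[THEN DERIV_chain2])
    have d1: "((\<lambda>y. f1 (of_nat n + y)) has_field_derivative f2 z) (at (of_real y))"
      using z s unfolding f1_def f2_def z_def
      by (auto intro!: derivative_eq_intros has_field_derivative_powr[THEN DERIV_chain2])
    have d2: "((\<lambda>y. f2 (of_nat n + y)) has_field_derivative s * (s + 1) * z powr (- s - 2)) (at (of_real y))"
      using z s unfolding f2_def z_def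
      by (auto intro!: derivative_eq_intros has_field_derivative_powr[THEN DERIV_chain2] simp: algebra_simps)
    have "(G has_field_derivative of_real (y * (1 - y) / 2) * (s * (s + 1)) * z powr (-s - 2)) (at (of_real y))"
      unfolding G_def by (rule derivative_eq_intros d0 d1 d2 refl | simp add: z_def[symmetric] field_simps)+
    thus "((\<lambda>y. G (of_real y)) has_vector_derivative of_real (y * (1 - y) / 2) * (s * (s + 1)) * of_real (real n + y) powr (-s - 2)) (at y within {0..1})"
      by (intro has_vector_derivative_real_field) (simp add: z_def)
  qed auto
  also have "G (of_real 1) - G (of_real 0) = zeta_trapezoid n s"
  proof -
    have eq: "zeta_trapezoid n s = (f1 (of_nat n) + f1 (of_nat n + 1)) / 2 - (f0 (of_nat n + 1) - f0 (of_nat n))"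
      by (simp add: zeta_trapezoid_def f0_def f1_def diff_divide_distrib add_ac)
    show ?thesis unfolding eq by (simp add: G_def field_simps)
  qed
  finally show ?thesis .
qed

text \<open>For \<open>Re s > -1\<close> the exponent is below -1, which makes the series of
  trapezoid errors converge there.\<close>

lemma norm_zeta_trapezoid_le:
  fixes s :: complex
  assumes n: "n > 0" and s: "s \<noteq> 1" "Re s > -1"
  shows "norm (zeta_trapezoid n s) \<le> norm (s * (s + 1)) * real n powr (- Re s - 2)"
proof -
  have "norm (zeta_trapezoid n s) \<le> norm (s * (s + 1)) * real n powr (- Re s - 2) * measure lborel (cbox 0 (1::real))"
  proof (rule has_integral_bound)
    show "((\<lambda>y. of_real (y * (1 - y) / 2) * (s * (s + 1)) * of_real (real n + y) powr (-s - 2))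
           has_integral zeta_trapezoid n s) (cbox 0 1)"
      using zeta_trapezoid_has_integral[OF n s(1)] by simp
  next
    fix y :: real assume "y \<in> cbox 0 1"
    hence y: "0 \<le> y" "y \<le> 1" by auto
    have "norm (complex_of_real (real n + y) powr (-s - 2)) = (real n + y) powr (- Re s - 2)"
      using y by (subst norm_powr_real_powr) auto
    also have "\<dots> \<le> real n powr (- Re s - 2)" using n s y by (intro powr_mono2') auto
    finally have 1: "norm (complex_of_real (real n + y) powr (-s - 2)) \<le> real n powr (- Re s - 2)" .
    have "y * (1 - y) \<le> 1 * 1" using y by (intro mult_mono) auto
    hence 2: "norm (complex_of_real (y * (1 - y) / 2)) \<le> 1" using y unfolding norm_of_real by simp
    have "norm (of_real (y * (1 - y) / 2) * (s * (s + 1)) * of_real (real n + y) powr (-s - 2)) =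
      norm (complex_of_real (y * (1 - y) / 2)) * norm (s * (s + 1)) * norm (complex_of_real (real n + y) powr (-s - 2))"
      by (simp only: norm_mult)
    also have "\<dots> \<le> 1 * norm (s * (s + 1)) * real n powr (- Re s - 2)"
      by (intro mult_mono 1 2) auto
    finally show "norm (of_real (y * (1 - y) / 2) * (s * (s + 1)) * of_real (real n + y) powr (-s - 2)) \<le> norm (s * (s + 1)) * real n powr (- Re s - 2)"
      by simp
  qed auto
  thus ?thesis by simp
qed

definition zeta_right :: "complex \<Rightarrow> complex" where
  "zeta_right s = (\<Sum>n. zeta_trapezoid n s)"

lemma zeta_trapezoid_uniform_limit:
  assumes "cball s d \<subseteq> {s. Re s > -1} - {1}" "d \<ge> 0"
  shows "uniform_limit (cball s d) (\<lambda>N s. \<Sum>n<N. zeta_trapezoid n s) zeta_right sequentially"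
proof -
  define C where "C = (norm s + d) * (norm s + d + 1)"
  define e where "e = - (Re s - d) - 2"
  \<comment> \<open>The leftmost point of the ball; it determines the worst exponent
    \<open>e\<close>.\<close>
  have "s - of_real d \<in> cball s d" using assms by (simp add: dist_norm)
  hence "Re (s - of_real d) > -1" using assms by blast
  hence e: "e < -1" by (simp add: e_def)
  have "uniform_limit (cball s d) (\<lambda>N s. \<Sum>n<N. zeta_trapezoid n s) (\<lambda>s. \<Sum>n. zeta_trapezoid n s) sequentially"
  proof (rule Weierstrass_m_test_ev)
    show "summable (\<lambda>n. C * real n powr e)"
      using e by (intro summable_mult) (simp add: summable_real_powr_iff)
    show "\<forall>\<^sub>F n in sequentially. \<forall>z\<in>cball s d. norm (zeta_trapezoid n z) \<le> C * real n powr e"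
      using eventually_gt_at_top[of 0]
    proof eventually_elim
      case (elim n)
      show ?case
      proof
        fix z assume z: "z \<in> cball s d"
        hence "z \<noteq> 1" "Re z > -1" using assms by auto
        have sz: "norm (z - s) \<le> d" using z by (simp add: dist_norm norm_minus_commute)
        have 1: "norm z \<le> norm s + d" using sz norm_triangle_sub[of z s] by linarith
        hence 2: "norm (z + 1) \<le> norm s + d + 1" using norm_triangle_ineq[of z 1] by simp
        have "\<bar>Re (z - s)\<bar> \<le> d" using abs_Re_le_cmod[of "z - s"] sz by linarith
        hence 3: "- Re z - 2 \<le> e" by (simp add: e_def abs_le_iff)
        have "norm (zeta_trapezoid n z) \<le> norm (z * (z + 1)) * real n powr (- Re z - 2)"
          by (rule norm_zeta_trapezoid_le) fact+
        also have "\<dots> \<le> C * real n powr e"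
          unfolding C_def norm_mult using elim 3 assms(2)
          by (intro mult_mono 1 2 powr_mono) auto
        finally show "norm (zeta_trapezoid n z) \<le> C * real n powr e" .
      qed
    qed
  qed
  thus ?thesis by (simp add: zeta_right_def[abs_def])
qed

lemma open_halfplane_punctured: "open ({s. Re s > c} - {1::complex})"
  by (intro open_Diff open_halfspace_Re_gt) auto

lemma holomorphic_zeta_right: "zeta_right holomorphic_on ({s. Re s > -1} - {1})"
proof (rule holomorphic_uniform_sequence[OF open_halfplane_punctured])
  show "(\<lambda>s. \<Sum>n<N. zeta_trapezoid n s) holomorphic_on ({s. Re s > -1} - {1})" for N
    by (intro holomorphic_on_sum holomorphic_on_subset[OF holomorphic_zeta_trapezoid]) auto
next
  fix s :: complex assume "s \<in> {s. Re s > -1} - {1}"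
  then obtain d where "d > 0" "cball s d \<subseteq> {s. Re s > -1} - {1}"
    using open_halfplane_punctured open_contains_cball by blast
  thus "\<exists>d>0. cball s d \<subseteq> {s. Re s > -1} - {1} \<and>
     uniform_limit (cball s d) (\<lambda>N s. \<Sum>n<N. zeta_trapezoid n s) zeta_right sequentially"
    using zeta_trapezoid_uniform_limit by (intro exI[of _ d]) auto
qed

lemma zeta_trapezoid_sums:
  assumes "Re s > -1" "s \<noteq> 1"
  shows "(\<lambda>n. zeta_trapezoid n s) sums zeta_right s"
proof -
  \<comment> \<open>Pointwise convergence is uniform convergence on a ball of radius 0.\<close>
  have "cball s 0 \<subseteq> {s. Re s > -1} - {1}" using assms by auto
  from zeta_trapezoid_uniform_limit[OF this] show ?thesis
    unfolding sums_def by (rule tendsto_uniform_limitI) auto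
qed

text \<open>Adding the telescoping differences of \<open>a / 2\<close> and \<open>b\<close> turns
  each trapezoid error into \<open>(n+1) powr (-s)\<close>. They contribute nothing in total: both
  sequences tend to 0 for \<open>Re s > 1\<close> and start at 0, since
  \<open>0 powr z = 0\<close>.\<close>

lemma zeta_right_series:
  assumes s: "Re s > 1"
  shows "(\<lambda>n. of_nat (Suc n) powr (-s)) sums zeta_right s"
proof -
  define a b where "a = (\<lambda>n::nat. of_nat n powr (-s))" and "b = (\<lambda>n::nat. of_nat n powr (1 - s) / (1 - s))"
  have s1: "s \<noteq> 1" using s by auto
  have a: "a \<longlonglongrightarrow> 0" unfolding a_def using s by (intro tendsto_neg_powr_complex_of_nat filterlim_ident) auto
  have "(\<lambda>n. of_nat n powr (1 - s)) \<longlonglongrightarrow> 0"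
    using s by (intro tendsto_neg_powr_complex_of_nat filterlim_ident) auto
  from tendsto_divide[OF this tendsto_const, of "1 - s"] have b: "b \<longlonglongrightarrow> 0" unfolding b_def using s1 by simp
  have "(\<lambda>n. zeta_trapezoid n s + (a (Suc n) - a n) / 2 + (b (Suc n) - b n)) sums
      (zeta_right s + (0 - a 0) / 2 + (0 - b 0))"
    using s s1 by (intro sums_add sums_divide telescope_sums a b zeta_trapezoid_sums) auto
  also have "zeta_right s + (0 - a 0) / 2 + (0 - b 0) = zeta_right s" by (simp add: a_def b_def)
  also have "(\<lambda>n. zeta_trapezoid n s + (a (Suc n) - a n) / 2 + (b (Suc n) - b n)) = (\<lambda>n. of_nat (Suc n) powr (-s))"
    by (auto simp: zeta_trapezoid_def a_def b_def fun_eq_iff diff_divide_distrib add_divide_distrib)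
  finally show ?thesis .
qed

section \<open>The functional equation\<close>

text \<open>For \<open>s < 0\<close> the integral formula extends to \<open>n = 0\<close>. Dividing
  by \<open>s * (s + 1)\<close>, which is negative here, leaves a nonnegative integrand.\<close>

lemma zeta_trapezoid_real:
  fixes s :: real
  assumes s: "-1 < s" "s < 0"
  obtains r where "zeta_trapezoid n (of_real s) = of_real r"
    "((\<lambda>y. y * (1 - y) / 2 * (real n + y) powr (-s - 2)) has_integral r / (s * (s + 1))) {0..1}"
proof -
  define p where "p = (\<lambda>n x. if n = 0 then 0 else real n powr x)"
  have p: "of_nat n powr of_real x = complex_of_real (p n x)" for n x
    using powr_of_real[of "real n" x] by (simp add: p_def)
  define r where "r = (p n (-s) + p (Suc n) (-s)) / 2 - (p (Suc n) (1 - s) - p n (1 - s)) / (1 - s)"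
  have r: "zeta_trapezoid n (of_real s) = of_real r"
    unfolding zeta_trapezoid_def r_def
    using p[of n "-s"] p[of "Suc n" "-s"] p[of n "1-s"] p[of "Suc n" "1-s"] by simp
  have "((\<lambda>y. y * (1 - y) / 2 * (real n + y) powr (-s - 2)) has_integral r / (s * (s + 1))) {0..1}"
  proof (cases "n = 0")
    case True
    \<comment> \<open>For \<open>n = 0\<close> the integrand splits into two powers, whose exponents
      \<open>-s - 1\<close> and \<open>-s\<close> both exceed -1.\<close>
    have "((\<lambda>y. (y powr (-s - 1) - y powr (-s)) / 2) has_integral
           (1 powr (-s - 1 + 1) / (-s - 1 + 1) - 1 powr (-s + 1) / (-s + 1)) / 2) {0..1}"
      using s by (intro has_integral_divide has_integral_diff has_integral_powr_from_0) auto
    also have "(1 powr (-s - 1 + 1) / (-s - 1 + 1) - 1 powr (-s + 1) / (-s + 1)) / 2 = r / (s * (s + 1))"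
      using s True by (simp add: r_def p_def divide_simps) (simp add: algebra_simps)
    finally show ?thesis
    proof (rule has_integral_eq[rotated])
      fix y :: real assume y: "y \<in> {0..1}"
      show "(y powr (-s - 1) - y powr (-s)) / 2 = y * (1 - y) / 2 * (real n + y) powr (-s - 2)"
      proof (cases "y = 0")
        case False
        with y have "y powr (-s - 1) = y * y powr (- s - 2)" "y powr (-s) = y * y * y powr (- s - 2)"
          by (simp_all add: powr_diff power2_eq_square)
        thus ?thesis using True by (simp add: algebra_simps)
      qed (use True in auto)
    qed
  next
    case False
    have "((\<lambda>y. Re (of_real (y * (1 - y) / 2) * (of_real s * (of_real s + 1)) * of_real (real n + y) powr (-of_real s - 2)))
           has_integral Re (zeta_trapezoid n (of_real s))) {0..1}"
      using False s by (intro has_integral_Re zeta_trapezoid_has_integral) auto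
    hence "((\<lambda>y. Re (of_real (y * (1 - y) / 2) * (of_real s * (of_real s + 1)) * of_real (real n + y) powr (-of_real s - 2)) / (s * (s + 1)))
           has_integral r / (s * (s + 1))) {0..1}"
      unfolding r by (intro has_integral_divide) simp
    moreover have cancel: "a * k * c / k = a * c" if "k \<noteq> 0" for a k c :: real using that by simp
    ultimately show ?thesis
    proof (elim has_integral_eq[rotated])
      fix y :: real assume y: "y \<in> {0..1}"
      have "complex_of_real (real n + y) powr (-of_real s - 2) = of_real ((real n + y) powr (-s - 2))"
        using y by (subst powr_of_real[symmetric]) auto
      hence E: "of_real (y * (1 - y) / 2) * (of_real s * (of_real s + 1)) * of_real (real n + y) powr (-of_real s - 2) =
         complex_of_real (y * (1 - y) / 2 * (s * (s + 1)) * (real n + y) powr (-s - 2))"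
        by (simp only: of_real_mult of_real_add of_real_1 mult_ac)
      have nz: "s * (s + 1) \<noteq> 0" using s by auto
      show "Re (of_real (y * (1 - y) / 2) * (of_real s * (of_real s + 1)) * of_real (real n + y) powr (-of_real s - 2)) / (s * (s + 1))
        = y * (1 - y) / 2 * (real n + y) powr (-s - 2)"
        unfolding E Re_complex_of_real by (rule cancel[OF nz])
    qed
  qed
  with r show ?thesis by (rule that)
qed

lemma nn_integral_Gamma_scaled:
  fixes c x :: real
  assumes c: "c > 0" and x: "x > 0"
  shows "(\<integral>\<^sup>+u. ennreal (u powr (c - 1) * exp (- (u * x))) * indicator {0<..} u \<partial>lborel) = ennreal (Gamma c * x powr (-c))"
proof -
  have [measurable]: "(\<lambda>t::real. ennreal (indicator {0..} t * t powr (c - 1) / exp t)) \<in> borel_measurable borel"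
    by measurable
  have "ennreal (Gamma c) = \<bar>x\<bar> * (\<integral>\<^sup>+t. ennreal (indicator {0..} (0 + x * t) * (0 + x * t) powr (c - 1) / exp (0 + x * t)) \<partial>lborel)"
    unfolding Gamma_conv_nn_integral_real[OF c] using x by (intro nn_integral_real_affine) auto
  also have "(\<integral>\<^sup>+t. ennreal (indicator {0..} (0 + x * t) * (0 + x * t) powr (c - 1) / exp (0 + x * t)) \<partial>lborel) =
     (\<integral>\<^sup>+t. ennreal (x powr (c - 1)) * (ennreal (t powr (c - 1) * exp (- (t * x))) * indicator {0<..} t) \<partial>lborel)"
    using x by (intro nn_integral_cong)
      (auto simp: indicator_def powr_mult exp_minus field_simps ennreal_mult[symmetric] zero_le_mult_iff)
  also have "\<dots> = ennreal (x powr (c - 1)) * (\<integral>\<^sup>+t. ennreal (t powr (c - 1) * exp (- (t * x))) * indicator {0<..} t \<partial>lborel)"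
    by (subst nn_integral_cmult) auto
  finally have "ennreal (Gamma c) = ennreal (x powr c) * (\<integral>\<^sup>+t. ennreal (t powr (c - 1) * exp (- (t * x))) * indicator {0<..} t \<partial>lborel)"
    using x by (simp add: mult.assoc[symmetric] ennreal_mult[symmetric] powr_diff)
  hence "ennreal (x powr (-c)) * ennreal (Gamma c) = ennreal (x powr (-c) * x powr c) * (\<integral>\<^sup>+t. ennreal (t powr (c - 1) * exp (- (t * x))) * indicator {0<..} t \<partial>lborel)"
    by (simp add: ennreal_mult mult.assoc)
  thus ?thesis using x c by (simp add: powr_add[symmetric] ennreal_mult[symmetric] mult.commute Gamma_real_pos less_imp_le)
qed

text \<open>The trapezoid error of \<open>exp (- (u * y))\<close> on the unit interval, divided by
  the \<open>u^2\<close> that its second derivative brings.\<close>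

lemma has_integral_exp_trapezoid:
  fixes u :: real
  assumes u: "u > 0"
  shows "((\<lambda>y. y * (1 - y) / 2 * exp (- (u * y))) has_integral
     ((1 + exp (-u)) / 2 - (1 - exp (-u)) / u) / u^2) {0..1}"
proof -
  define G where "G = (\<lambda>y. ((y * (1 - y) * (- u * exp (- (u * y))) - (1 - 2 * y) * exp (- (u * y)) + 2 * exp (- (u * y)) / u) / 2) / u^2)"
  have "((\<lambda>y. y * (1 - y) / 2 * exp (- (u * y))) has_integral G 1 - G 0) {0..1}"
  proof (rule fundamental_theorem_of_calculus)
    fix y :: real
    have "(G has_real_derivative y * (1 - y) / 2 * exp (- (u * y))) (at y within {0..1})"
      unfolding G_def using u
      by (auto intro!: derivative_eq_intros simp: power2_eq_square field_simps)
    thus "(G has_vector_derivative y * (1 - y) / 2 * exp (- (u * y))) (at y within {0..1})"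
      by (simp add: has_real_derivative_iff_has_vector_derivative)
  qed auto
  also have "G 1 - G 0 = ((1 + exp (-u)) / 2 - (1 - exp (-u)) / u) / u^2"
    using u by (simp add: G_def field_simps)
  finally show ?thesis .
qed

text \<open>Equal to \<open>1/(e\<^sup>u-1) + 1/2 - 1/u\<close>.\<close>
definition bose_kernel :: "real \<Rightarrow> real" where
  "bose_kernel u = (1 + exp (-u)) / (2 * (1 - exp (-u))) - 1 / u"

text \<open>Shifting by \<open>n\<close> multiplies the integral by \<open>exp (-u) ^ n\<close>, so
  the sum is a geometric series.\<close>

lemma suminf_trapezoid_kernel:
  fixes u :: real
  assumes u: "u > 0"
  shows "(\<Sum>n. \<integral>\<^sup>+y. ennreal (y * (1 - y) / 2 * exp (- (u * (real n + y)))) * indicator {0..1} y \<partial>lborel) = ennreal (bose_kernel u / u^2)"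
proof -
  define J where "J = ((1 + exp (-u)) / 2 - (1 - exp (-u)) / u) / u^2"
  have J: "((\<lambda>y. y * (1 - y) / 2 * exp (- (u * y))) has_integral J) {0..1}"
    unfolding J_def by (rule has_integral_exp_trapezoid[OF u])
  hence J0: "J \<ge> 0" by (rule has_integral_nonneg) auto
  have "(\<integral>\<^sup>+y. ennreal (y * (1 - y) / 2 * exp (- (u * (real n + y)))) * indicator {0..1} y \<partial>lborel) = ennreal (J * exp (-u) ^ n)" for n
  proof (rule nn_integral_has_integral_lebesgue')
    have "((\<lambda>y. y * (1 - y) / 2 * exp (- (u * y)) * exp (-u) ^ n) has_integral J * exp (-u) ^ n) {0..1}"
      by (intro has_integral_mult_left J)
    also have "(\<lambda>y. y * (1 - y) / 2 * exp (- (u * y)) * exp (-u) ^ n) = (\<lambda>y. y * (1 - y) / 2 * exp (- (u * (real n + y))))"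
      by (simp add: fun_eq_iff exp_of_nat_mult[symmetric] exp_add[symmetric] algebra_simps)
    finally show "((\<lambda>y. y * (1 - y) / 2 * exp (- (u * (real n + y)))) has_integral J * exp (-u) ^ n) {0..1}" .
  qed auto
  moreover have "(\<lambda>n. J * exp (-u) ^ n) sums (J * (1 / (1 - exp (-u))))"
    using u by (intro sums_mult geometric_sums) simp
  hence "(\<Sum>n. ennreal (J * exp (-u) ^ n)) = ennreal (J * (1 / (1 - exp (-u))))"
    using J0 by (intro suminf_ennreal_eq) auto
  moreover have "J * (1 / (1 - exp (-u))) = bose_kernel u / u^2"
    using u by (simp add: J_def bose_kernel_def divide_simps)
  ultimately show ?thesis by simp
qed

text \<open>\<open>Gamma s * r\<close> is \<open>Gamma (s + 2)\<close> times the integral in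
  \<open>r\<close>. Writing \<open>Gamma (s + 2) * (n + y) powr (-s - 2)\<close> as a Gamma integral
  over \<open>u\<close> and exchanging the integrals by Tonelli gives the formula.\<close>

lemma Gamma_zeta_trapezoid_nn_integral:
  fixes s r :: real
  assumes s: "-1 < s" "s < 0"
    and r: "((\<lambda>y. y * (1 - y) / 2 * (real n + y) powr (-s - 2)) has_integral r / (s * (s + 1))) {0..1}"
  shows "ennreal (Gamma s * r) =
    (\<integral>\<^sup>+u. ennreal (u powr (s + 1)) * indicator {0<..} u *
      (\<integral>\<^sup>+y. ennreal (y * (1 - y) / 2 * exp (- (u * (real n + y)))) * indicator {0..1} y \<partial>lborel) \<partial>lborel)"
    and "Gamma s * r \<ge> 0"
proof -
  have "s \<notin> \<int>\<^sub>\<le>\<^sub>0"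
  proof
    assume "s \<in> \<int>\<^sub>\<le>\<^sub>0"
    then obtain k where "s = - of_nat k" by (rule nonpos_Ints_cases')
    thus False using s by (cases k) auto
  qed
  moreover have "s + 1 \<notin> \<int>\<^sub>\<le>\<^sub>0" using s nonpos_Ints_nonpos[of "s + 1"] by auto
  ultimately have "Gamma (s + 1 + 1) = (s + 1) * (s * Gamma s)"
    by (simp only: Gamma_plus1 not_False_eq_True)
  moreover have "s + 1 + 1 = s + 2" by simp
  ultimately have G: "Gamma (s + 2) = s * (s + 1) * Gamma s" by (simp only: mult_ac)
  have "((\<lambda>y. Gamma (s + 2) * (y * (1 - y) / 2 * (real n + y) powr (-s - 2))) has_integral Gamma (s + 2) * (r / (s * (s + 1)))) {0..1}"
    by (intro has_integral_mult_right r)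
  also have "Gamma (s + 2) * (r / (s * (s + 1))) = Gamma s * r" using s by (simp add: G)
  finally have I: "((\<lambda>y. Gamma (s + 2) * (y * (1 - y) / 2 * (real n + y) powr (-s - 2))) has_integral Gamma s * r) {0..1}" .
  have Gpos: "Gamma (s + 2) > 0" using s by (intro Gamma_real_pos) auto
  show "Gamma s * r \<ge> 0" by (rule has_integral_nonneg[OF I]) (use Gpos in auto)
  have "ennreal (Gamma s * r) = (\<integral>\<^sup>+y. ennreal (Gamma (s + 2) * (y * (1 - y) / 2 * (real n + y) powr (-s - 2))) * indicator {0..1} y \<partial>lborel)"
    using Gpos by (intro nn_integral_has_integral_lebesgue'[symmetric] I) auto
  also have "\<dots> = (\<integral>\<^sup>+y. (\<integral>\<^sup>+u. ennreal (u powr (s + 1)) * indicator {0<..} u *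
      (ennreal (y * (1 - y) / 2 * exp (- (u * (real n + y)))) * indicator {0..1} y) \<partial>lborel) \<partial>lborel)"
  \<comment> \<open>The point \<open>y = 0\<close> is left out because \<open>n + y\<close> vanishes
    there when \<open>n = 0\<close>.\<close>
  proof (rule nn_integral_cong_AE, rule AE_mp[OF AE_lborel_singleton[of 0]], rule AE_I2, rule impI)
    fix y :: real assume y0: "y \<noteq> 0"
    show "ennreal (Gamma (s + 2) * (y * (1 - y) / 2 * (real n + y) powr (-s - 2))) * indicator {0..1} y =
      (\<integral>\<^sup>+u. ennreal (u powr (s + 1)) * indicator {0<..} u *
      (ennreal (y * (1 - y) / 2 * exp (- (u * (real n + y)))) * indicator {0..1} y) \<partial>lborel)"
    proof (cases "y \<in> {0..1}")
      case True
      hence y: "0 < y" "y \<le> 1" using y0 by auto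
      have "ennreal (Gamma (s + 2) * (y * (1 - y) / 2 * (real n + y) powr (-s - 2))) = ennreal (y * (1 - y) / 2) * ennreal (Gamma (s + 2) * (real n + y) powr (-(s + 2)))"
        using y Gpos by (subst ennreal_mult[symmetric]) (auto simp: algebra_simps)
      also have "\<dots> = ennreal (y * (1 - y) / 2) * (\<integral>\<^sup>+u. ennreal (u powr (s + 2 - 1) * exp (- (u * (real n + y)))) * indicator {0<..} u \<partial>lborel)"
        using y s by (subst nn_integral_Gamma_scaled) auto
      also have "\<dots> = (\<integral>\<^sup>+u. ennreal (y * (1 - y) / 2) * (ennreal (u powr (s + 2 - 1) * exp (- (u * (real n + y)))) * indicator {0<..} u) \<partial>lborel)"
        by (subst nn_integral_cmult) auto
      also have "\<dots> = (\<integral>\<^sup>+u. ennreal (u powr (s + 1)) * indicator {0<..} u * ennreal (y * (1 - y) / 2 * exp (- (u * (real n + y)))) \<partial>lborel)"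
        using y by (intro nn_integral_cong) (auto simp: indicator_def ennreal_mult[symmetric] mult_ac add_ac)
      finally show ?thesis using True by simp
    qed auto
  qed
  also have "\<dots> = (\<integral>\<^sup>+u. (\<integral>\<^sup>+y. ennreal (u powr (s + 1)) * indicator {0<..} u *
      (ennreal (y * (1 - y) / 2 * exp (- (u * (real n + y)))) * indicator {0..1} y) \<partial>lborel) \<partial>lborel)"
    by (rule lborel_pair.Fubini') measurable
  also have "\<dots> = (\<integral>\<^sup>+u. ennreal (u powr (s + 1)) * indicator {0<..} u *
      (\<integral>\<^sup>+y. ennreal (y * (1 - y) / 2 * exp (- (u * (real n + y)))) * indicator {0..1} y \<partial>lborel) \<partial>lborel)"
    by (intro nn_integral_cong nn_integral_cmult) measurable
  finally show "ennreal (Gamma s * r) =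
    (\<integral>\<^sup>+u. ennreal (u powr (s + 1)) * indicator {0<..} u *
      (\<integral>\<^sup>+y. ennreal (y * (1 - y) / 2 * exp (- (u * (real n + y)))) * indicator {0..1} y \<partial>lborel) \<partial>lborel)" .
qed

section \<open>The integral of a single partial fraction\<close>

text \<open>The substitution \<open>t = u^2 / (1 + u^2)\<close> turns the Beta integral with
  parameters \<open>(1 + s) / 2\<close> and \<open>(1 - s) / 2\<close> into this one. The parameters
  add up to 1, so the reflection formula gives the value.\<close>

lemma has_integral_powr_over_square_plus_1:
  fixes s :: real
  assumes s: "-1 < s" "s < 1"
  shows "((\<lambda>u. 2 * u powr s / (u^2 + 1)) has_integral pi / cos (pi * s / 2)) {0<..}"
proof -
  define a b where "a = (1 + s) / 2" and "b = (1 - s) / 2"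
  define g where "g = (\<lambda>u::real. u^2 / (1 + u^2))"
  define f where "f = (\<lambda>t::real. t powr (a - 1) * (1 - t) powr (b - 1))"
  have pos: "1 + u^2 > 0" for u :: real by (simp add: add_pos_nonneg)
  have ab: "a > 0" "b > 0" "a + b = 1" using s by (auto simp: a_def b_def add_divide_distrib[symmetric])
  have "(f has_integral Beta a b) {0<..<1}"
    using has_integral_Beta_real[OF ab(1,2)] by (simp add: f_def has_integral_Icc_iff_Ioo)
  hence f: "f absolutely_integrable_on {0<..<1} \<and> integral {0<..<1} f = Beta a b"
    by (auto simp: f_def has_integral_iff intro!: nonnegative_absolutely_integrable_1)
  have img: "g ` {0<..} = {0<..<1}"
  proof safe
    fix t :: real assume t: "t \<in> {0<..<1}"
    define u where "u = sqrt (t / (1 - t))"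
    have "u > 0" "u^2 = t / (1 - t)" using t by (auto simp: u_def)
    moreover have "1 + t / (1 - t) = 1 / (1 - t)" using t by (simp add: field_simps)
    ultimately have "g u = t" using t by (simp add: g_def)
    thus "t \<in> g ` {0<..}" using \<open>u > 0\<close> by (metis greaterThan_iff imageI)
  next
    fix u :: real assume "u > 0"
    thus "g u \<in> {0<..<1}" using pos[of u] by (simp add: g_def divide_less_eq_1)
  qed
  have inj: "inj_on g {0<..}"
  proof (rule inj_onI)
    fix x y assume xy: "x \<in> {0<..}" "y \<in> {0<..}" "g x = g y"
    have "1 - g v = 1 / (1 + v^2)" for v using pos[of v] by (simp add: g_def field_simps)
    with xy have "1 / (1 + x^2) = 1 / (1 + y^2)" by metis
    hence "x^2 = y^2" by simp
    thus "x = y" using xy by (simp add: power2_eq_iff_nonneg)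
  qed
  have der: "(g has_field_derivative 2 * u / (1 + u^2)^2) (at u within {0<..})" for u
    unfolding g_def using pos[of u]
    by (auto intro!: derivative_eq_intros simp: field_simps power2_eq_square)
  have "(\<lambda>u. \<bar>2 * u / (1 + u^2)^2\<bar> * f (g u)) absolutely_integrable_on {0<..} \<and>
         integral {0<..} (\<lambda>u. \<bar>2 * u / (1 + u^2)^2\<bar> * f (g u)) = Beta a b"
    using f img by (subst has_absolute_integral_change_of_variables_1'[OF _ der inj]) auto
  hence "((\<lambda>u. \<bar>2 * u / (1 + u^2)^2\<bar> * f (g u)) has_integral Beta a b) {0<..}"
    by (auto simp: has_integral_iff set_lebesgue_integral_eq_integral)
  hence "((\<lambda>u. 2 * u powr s / (u^2 + 1)) has_integral Beta a b) {0<..}"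
  proof (rule has_integral_eq[rotated])
    fix u :: real assume "u \<in> {0<..}"
    hence u: "u > 0" by simp
    have 1: "1 - g u = 1 / (1 + u^2)" using pos[of u] by (simp add: g_def field_simps)
    have "f (g u) = (u^2) powr (a - 1) / ((1 + u^2) powr (a - 1) * (1 + u^2) powr (b - 1))"
      unfolding f_def 1 using u pos[of u] by (simp add: g_def powr_divide)
    also have "(1 + u^2) powr (a - 1) * (1 + u^2) powr (b - 1) = (1 + u^2) powr (- 1)"
      using ab(3) by (simp add: powr_add[symmetric] algebra_simps)
    also have "\<dots> = 1 / (1 + u^2)" using pos[of u] by (simp add: powr_minus_divide)
    also have "(u^2) powr (a - 1) = u powr (s - 1)"
    proof -
      have "u^2 = u powr 2" using u by simp
      hence "(u^2) powr (a - 1) = u powr (2 * (a - 1))" by (simp only: powr_powr)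
      also have "2 * (a - 1) = s - 1" by (simp add: a_def field_simps)
      finally show ?thesis .
    qed
    also have "u powr (s - 1) = u powr s / u" using u by (simp add: powr_diff)
    finally have "f (g u) = u powr s * (1 + u^2) / u" by simp
    thus "\<bar>2 * u / (1 + u^2)^2\<bar> * f (g u) = 2 * u powr s / (u^2 + 1)"
      using u pos[of u] by (simp add: power2_eq_square divide_simps add.commute mult.commute)
  qed
  also have "Beta a b = pi / cos (pi * s / 2)"
  proof -
    have "b = 1 - a" using ab(3) by simp
    have "complex_of_real (Gamma a * Gamma b) = Gamma (of_real a) * Gamma (1 - of_real a)"
      unfolding \<open>b = 1 - a\<close> by (simp flip: Gamma_complex_of_real)
    also have "\<dots> = complex_of_real (pi / sin (pi * a))"
      unfolding Gamma_reflection_complex by (simp flip: sin_of_real)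
    finally have "Gamma a * Gamma b = pi / sin (pi * a)" by (simp only: of_real_eq_iff)
    moreover have "pi * a = pi / 2 + pi * s / 2" by (simp add: a_def field_simps)
    hence "sin (pi * a) = cos (pi * s / 2)" by (simp only: sin_add) simp
    ultimately show ?thesis by (simp add: Beta_def ab)
  qed
  finally show ?thesis .
qed

lemma nn_integral_powr_over_square_plus_square:
  fixes s c :: real
  assumes s: "-1 < s" "s < 1" and c: "c > 0"
  shows "(\<integral>\<^sup>+u. ennreal (2 * u powr s / (u^2 + c^2)) * indicator {0<..} u \<partial>lborel) = ennreal (c powr (s - 1) * (pi / cos (pi * s / 2)))"
proof -
  have "(\<integral>\<^sup>+u. ennreal (2 * u powr s / (u^2 + c^2)) * indicator {0<..} u \<partial>lborel) =
     \<bar>c\<bar> * (\<integral>\<^sup>+u. ennreal (2 * (0 + c * u) powr s / ((0 + c * u)^2 + c^2)) * indicator {0<..} (0 + c * u) \<partial>lborel)"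
    using c by (intro nn_integral_real_affine) auto
  also have "(\<integral>\<^sup>+u. ennreal (2 * (0 + c * u) powr s / ((0 + c * u)^2 + c^2)) * indicator {0<..} (0 + c * u) \<partial>lborel) =
     (\<integral>\<^sup>+u. ennreal (c powr s / c^2) * (ennreal (2 * u powr s / (u^2 + 1)) * indicator {0<..} u) \<partial>lborel)"
  proof (intro nn_integral_cong)
    fix u :: real
    have "2 * (c * u) powr s / ((c * u)^2 + c^2) = c powr s / c^2 * (2 * u powr s / (u^2 + 1))" if "u > 0"
    proof -
      have "(c * u)^2 + c^2 = c^2 * (u^2 + 1)" by (simp add: power_mult_distrib algebra_simps)
      thus ?thesis using c that by (simp add: powr_mult)
    qed
    thus "ennreal (2 * (0 + c * u) powr s / ((0 + c * u)^2 + c^2)) * indicator {0<..} (0 + c * u) =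
      ennreal (c powr s / c^2) * (ennreal (2 * u powr s / (u^2 + 1)) * indicator {0<..} u)"
      using c by (auto simp: indicator_def zero_less_mult_iff simp flip: ennreal_mult)
  qed
  also have "\<dots> = ennreal (c powr s / c^2) * (\<integral>\<^sup>+u. ennreal (2 * u powr s / (u^2 + 1)) * indicator {0<..} u \<partial>lborel)"
    by (rule nn_integral_cmult) measurable
  also have "(\<integral>\<^sup>+u. ennreal (2 * u powr s / (u^2 + 1)) * indicator {0<..} u \<partial>lborel) = ennreal (pi / cos (pi * s / 2))"
    by (rule nn_integral_has_integral_lebesgue'[OF _ has_integral_powr_over_square_plus_1]) (use s in auto)
  also have "ennreal \<bar>c\<bar> * (ennreal (c powr s / c^2) * ennreal (pi / cos (pi * s / 2))) = ennreal (c powr (s - 1) * (pi / cos (pi * s / 2)))"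
  proof -
    have "\<bar>c\<bar> * (c powr s / c^2) = c powr (s - 1)" using c by (simp add: powr_diff power2_eq_square)
    moreover have "ennreal a * (ennreal b * ennreal d) = ennreal (a * b * d)" if "a \<ge> 0" "b \<ge> 0" for a b d
      using that by (simp add: ennreal_mult' mult.assoc)
    ultimately show ?thesis by simp
  qed
  finally show ?thesis .
qed

section \<open>Partial fractions of the cotangent and of \<open>bose_kernel\<close>\<close>

text \<open>By reflection \<open>Gamma w * Gamma (- w) * w * sin (pi * w)\<close> is the constant
  \<open>- pi\<close> off the integers. Its vanishing logarithmic derivative expresses
  \<open>Digamma z - Digamma (- z)\<close> by the cotangent, and the difference of the two digamma
  series is the sum of fractions.\<close>

lemma pi_cot_sums:
  fixes z :: complex
  assumes z: "z \<notin> \<int>"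
  shows "(\<lambda>k. 2 * z / (of_nat (Suc k) ^ 2 - z ^ 2)) sums (1 / z - of_real pi * cos (of_real pi * z) / sin (of_real pi * z))"
proof -
  have z0: "z \<noteq> 0" using z by auto
  have mz: "- z \<notin> \<int>" using z by (metis Ints_minus minus_minus)
  have nI: "z \<notin> \<int>\<^sub>\<le>\<^sub>0" "- z \<notin> \<int>\<^sub>\<le>\<^sub>0" using z mz nonpos_Ints_Int by blast+
  define S where "S = sin (of_real pi * z)"
  define C where "C = cos (of_real pi * z)"
  have S0: "S \<noteq> 0"
  proof
    assume "S = 0"
    then obtain n where "of_real pi * z = of_int n * of_real pi" by (auto simp: S_def sin_eq_0)
    hence "z = of_int n" by (simp add: mult.commute[of "of_real pi"])
    thus False using z by auto
  qed
  define h where "h = (\<lambda>w::complex. Gamma w * Gamma (- w) * (w * sin (of_real pi * w)))"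
  define D where "D = Gamma z * Gamma (- z) * (z * S) * (Digamma z - Digamma (- z) + 1 / z + of_real pi * C / S)"
  have "(h has_field_derivative D) (at z)"
    unfolding h_def D_def using nI z0 S0
    by (auto intro!: derivative_eq_intros simp: S_def C_def field_simps)
  moreover have "(h has_field_derivative 0) (at z)"
  proof (rule has_field_derivative_transform_within_open)
    show "((\<lambda>_. - of_real pi) has_field_derivative 0) (at z)" by simp
    show "open (- \<int> :: complex set)" by (simp add: open_Compl)
    show "z \<in> - \<int>" using z by simp
    fix w :: complex assume w: "w \<in> - \<int>"
    have "sin (of_real pi * w) \<noteq> 0"
    proof
      assume "sin (of_real pi * w) = 0"
      then obtain n where "of_real pi * w = of_int n * of_real pi" by (auto simp: sin_eq_0)
      hence "w = of_int n" by (simp add: mult.commute[of "of_real pi"])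
      thus False using w by auto
    qed
    moreover have "w \<noteq> 0" using w by auto
    ultimately show "- of_real pi = h w" by (simp add: h_def Gamma_reflection_complex')
  qed
  ultimately have "D = 0" by (rule DERIV_unique)
  moreover have "Gamma z \<noteq> 0" "Gamma (- z) \<noteq> 0" using nI by (auto simp: Gamma_eq_zero_iff)
  ultimately have "Digamma z - Digamma (- z) + 1 / z + of_real pi * C / S = 0"
    using z0 S0 by (simp only: D_def mult_eq_0_iff) simp
  moreover have "a = - b - c" if "a + b + c = 0" for a b c :: complex
    using that by algebra
  ultimately have cot: "Digamma z - Digamma (- z) = - 1 / z - of_real pi * C / S"
    by (metis minus_divide_left)
  have "(\<lambda>k. (inverse (of_nat (Suc k)) - inverse (z + of_nat k)) - (inverse (of_nat (Suc k)) - inverse (- z + of_nat k))) sums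
      ((Digamma z + euler_mascheroni) - (Digamma (- z) + euler_mascheroni))"
    using summable_sums[OF summable_Digamma[of z]] summable_sums[OF summable_Digamma[of "- z"]] z0
    by (intro sums_diff) (simp_all add: Digamma_def del: of_nat_Suc)
  also have "(\<lambda>k. (inverse (of_nat (Suc k)) - inverse (z + of_nat k)) - (inverse (of_nat (Suc k)) - inverse (- z + of_nat k)))
     = (\<lambda>k. 2 * z / (of_nat k ^ 2 - z ^ 2))"
  proof
    fix k :: nat
    have "of_nat k + z \<noteq> 0"
      using mz by (metis Ints_of_nat add.commute add_eq_0_iff)
    moreover have "of_nat k - z \<noteq> 0" using z by (metis Ints_of_nat right_minus_eq)
    ultimately have "2 * z / ((of_nat k + z) * (of_nat k - z)) = inverse (of_nat k - z) - inverse (of_nat k + z)"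
      by (simp add: field_simps)
    also have "(of_nat k + z) * (of_nat k - z) = of_nat k ^ 2 - z ^ 2" by (simp add: power2_eq_square algebra_simps)
    finally show "(inverse (of_nat (Suc k)) - inverse (z + of_nat k)) - (inverse (of_nat (Suc k)) - inverse (- z + of_nat k)) = 2 * z / (of_nat k ^ 2 - z ^ 2)"
      by (simp add: algebra_simps)
  qed
  finally have "(\<lambda>k. 2 * z / (of_nat k ^ 2 - z ^ 2)) sums (- 1 / z - of_real pi * C / S)" by (simp add: cot)
  \<comment> \<open>Removing the term at \<open>k = 0\<close>, which is \<open>- 2 / z\<close>,
    changes \<open>- 1 / z\<close> into \<open>1 / z\<close>.\<close>
  hence "(\<lambda>k. 2 * z / (of_nat (Suc k) ^ 2 - z ^ 2)) sums (- 1 / z - of_real pi * C / S - 2 * z / (of_nat 0 ^ 2 - z ^ 2))"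
    by (subst sums_Suc_iff) simp
  also have "- 1 / z - of_real pi * C / S - 2 * z / (of_nat 0 ^ 2 - z ^ 2) = 1 / z - of_real pi * C / S"
    using z0 by (simp add: power2_eq_square)
  finally show ?thesis by (simp add: S_def C_def)
qed

text \<open>This is \<open>pi_cot_sums\<close> at the imaginary point
  \<open>i * u / (2 * pi)\<close>, divided by \<open>2 * pi * i\<close>; the cotangent becomes
  hyperbolic, and \<open>bose_kernel u\<close> is \<open>coth (u/2) / 2 - 1/u\<close>.\<close>

lemma bose_kernel_sums:
  fixes u :: real
  assumes u: "u > 0"
  shows "(\<lambda>k. 2 * u / (u^2 + (2 * pi * real (Suc k))^2)) sums bose_kernel u"
proof -
  define y where "y = u / (2 * pi)"
  define z where "z = \<i> * complex_of_real y"
  have y: "y > 0" and u_eq: "u = 2 * pi * y" using u by (auto simp: y_def)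
  have "z \<notin> \<int>" using y by (auto simp: z_def Ints_def complex_eq_iff)
  from sums_divide[OF pi_cot_sums[OF this], of "2 * of_real pi * \<i>"]
  have "(\<lambda>k. 2 * z / (of_nat (Suc k) ^ 2 - z ^ 2) / (2 * of_real pi * \<i>)) sums
     ((1 / z - of_real pi * cos (of_real pi * z) / sin (of_real pi * z)) / (2 * of_real pi * \<i>))" .
  also have "(\<lambda>k. 2 * z / (of_nat (Suc k) ^ 2 - z ^ 2) / (2 * of_real pi * \<i>)) =
     (\<lambda>k. complex_of_real (2 * u / (u^2 + (2 * pi * real (Suc k))^2)))"
  proof
    fix k :: nat
    have "2 * z / (of_nat (Suc k) ^ 2 - z ^ 2) / (2 * of_real pi * \<i>) = complex_of_real (y / (pi * (real (Suc k) ^ 2 + y^2)))"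
    proof -
      have "2 * (\<i> * a) / d / (2 * p * \<i>) = a / (p * d)" for a d p :: complex
        by (cases "d = 0"; cases "p = 0") (auto simp: field_simps)
      thus ?thesis by (simp add: z_def power_mult_distrib)
    qed
    also have "y / (pi * (real (Suc k) ^ 2 + y^2)) = 2 * u / (u^2 + (2 * pi * real (Suc k))^2)"
    proof -
      have "u^2 + (2 * pi * real (Suc k))^2 = 4 * pi * (pi * (real (Suc k) ^ 2 + y^2))"
        by (simp add: u_eq power2_eq_square algebra_simps)
      thus ?thesis by (simp add: u_eq)
    qed
    finally show "2 * z / (of_nat (Suc k) ^ 2 - z ^ 2) / (2 * of_real pi * \<i>) = complex_of_real (2 * u / (u^2 + (2 * pi * real (Suc k))^2))" .
  qed
  also have "(1 / z - of_real pi * cos (of_real pi * z) / sin (of_real pi * z)) / (2 * of_real pi * \<i>) = of_real (bose_kernel u)"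
  proof -
    have pz: "of_real pi * z = Complex 0 (u / 2)" by (simp add: z_def u_eq complex_eq_iff)
    have C: "cos (of_real pi * z) = of_real (cosh (u / 2))"
      unfolding pz by (simp add: complex_eq_iff Re_cos Im_cos cosh_def)
    have S: "sin (of_real pi * z) = \<i> * of_real (sinh (u / 2))"
      unfolding pz by (simp add: complex_eq_iff Re_sin Im_sin sinh_def)
    have sh: "sinh (u / 2) > 0" using u by simp
    have "(1 / z - of_real pi * cos (of_real pi * z) / sin (of_real pi * z)) / (2 * of_real pi * \<i>)
       = of_real (cosh (u / 2) / (2 * sinh (u / 2)) - 1 / u)"
      unfolding C S using sh y by (simp add: z_def u_eq field_simps)
    also have "cosh (u / 2) / (2 * sinh (u / 2)) = (1 + exp (-u)) / (2 * (1 - exp (-u)))"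
    proof -
      have "exp (- u) = exp (- (u / 2)) * exp (- (u / 2))" by (simp flip: exp_add)
      moreover have "exp (u / 2) * exp (- (u / 2)) = 1" by (simp flip: exp_add)
      ultimately have "1 + exp (- u) = exp (- (u / 2)) * (2 * cosh (u / 2))" "1 - exp (-u) = exp (- (u / 2)) * (2 * sinh (u / 2))"
        by (simp_all add: cosh_field_def sinh_field_def algebra_simps)
      thus ?thesis using sh by simp
    qed
    finally show ?thesis by (simp add: bose_kernel_def)
  qed
  finally show ?thesis by (simp only: sums_of_real_iff)
qed

section \<open>The equation on a real interval\<close>

lemma holomorphic_chi_factor: "A \<inter> \<int>\<^sub>\<le>\<^sub>0 = {} \<Longrightarrow> chi_factor holomorphic_on A"
  unfolding chi_factor_def[abs_def] by (auto intro!: holomorphic_intros)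

text \<open>The integral of \<open>u powr (s - 1) * bose_kernel u\<close> over \<open>u > 0\<close>
  is evaluated twice: summing trapezoid errors gives \<open>Gamma s * R\<close>, summing partial
  fractions gives a multiple of \<open>Q\<close>.\<close>

lemma zeta_right_functional_equation_real:
  fixes s :: real
  assumes s: "-1 < s" "s < 0"
  shows "zeta_right (1 - of_real s) = chi_factor (of_real s) * zeta_right (of_real s)"
proof -
  have "\<exists>r. zeta_trapezoid n (of_real s) = of_real r \<and>
     ((\<lambda>y. y * (1 - y) / 2 * (real n + y) powr (-s - 2)) has_integral r / (s * (s + 1))) {0..1}" for n
    by (rule zeta_trapezoid_real[OF s, of n]) blast
  hence "\<forall>n. \<exists>r. zeta_trapezoid n (of_real s) = of_real r \<and>
     ((\<lambda>y. y * (1 - y) / 2 * (real n + y) powr (-s - 2)) has_integral r / (s * (s + 1))) {0..1}"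
    by blast
  from choice[OF this] obtain r where r: "\<And>n. zeta_trapezoid n (of_real s) = of_real (r n)"
     "\<And>n. ((\<lambda>y. y * (1 - y) / 2 * (real n + y) powr (-s - 2)) has_integral r n / (s * (s + 1))) {0..1}"
    by blast
  define R where "R = Re (zeta_right (of_real s))"
  have "(\<lambda>n. complex_of_real (r n)) sums zeta_right (of_real s)"
    using zeta_trapezoid_sums[of "of_real s"] s by (simp add: r)
  from sums_Re[OF this] sums_Im[OF this] have rR: "r sums R" and "Im (zeta_right (of_real s)) = 0"
    by (auto simp: R_def sums_iff)
  hence R: "zeta_right (of_real s) = of_real R" by (simp add: complex_eq_iff R_def)

  define a where "a = (\<lambda>n. real (Suc n) powr (s - 1))"
  define Q where "Q = Re (zeta_right (1 - of_real s))"
  have "(\<lambda>n. complex_of_real (a n)) = (\<lambda>n. of_nat (Suc n) powr (- (1 - of_real s)))"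
  proof
    fix n
    have "complex_of_real (a n) = of_real (real (Suc n)) powr of_real (s - 1)"
      unfolding a_def by (intro powr_of_real[symmetric]) auto
    thus "complex_of_real (a n) = of_nat (Suc n) powr (- (1 - of_real s))" by simp
  qed
  hence "(\<lambda>n. complex_of_real (a n)) sums zeta_right (1 - of_real s)"
    using zeta_right_series[of "1 - of_real s"] s by simp
  from sums_Re[OF this] sums_Im[OF this] have aQ: "a sums Q" and "Im (zeta_right (1 - of_real s)) = 0"
    by (auto simp: Q_def sums_iff)
  hence Q: "zeta_right (1 - of_real s) = of_real Q" by (simp add: complex_eq_iff Q_def)
  have "Q \<ge> 0" by (rule sums_le[OF _ sums_zero aQ]) (simp add: a_def)

  define K where "K = pi / cos (pi * s / 2)"
  have "pi * (- s) < pi * 1" "pi * s < 0" using s by (intro mult_strict_left_mono mult_pos_neg; simp)+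
  hence cos: "cos (pi * s / 2) > 0" by (intro cos_gt_zero_pi; linarith)
  hence K: "K > 0" by (simp add: K_def)

  have nonneg: "Gamma s * r n \<ge> 0" for n
    by (rule Gamma_zeta_trapezoid_nn_integral(2)[OF s r(2)])
  have sumsG: "(\<lambda>n. Gamma s * r n) sums (Gamma s * R)" by (intro sums_mult rR)
  \<comment> \<open>Nonnegativity of both final values is what allows the return from
    \<open>ennreal\<close> to the reals.\<close>
  have GR: "Gamma s * R \<ge> 0" by (rule sums_le[OF _ sums_zero sumsG]) (simp add: nonneg)

  define I where "I = (\<lambda>n u. \<integral>\<^sup>+y. ennreal (y * (1 - y) / 2 * exp (- (u * (real n + y)))) * indicator {0..1} y \<partial>lborel)"
  have [measurable]: "I n \<in> borel_measurable borel" for n unfolding I_def by measurable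
  have "ennreal (Gamma s * R) = (\<Sum>n. ennreal (Gamma s * r n))"
    by (intro suminf_ennreal_eq[symmetric] sumsG nonneg)
  also have "\<dots> = (\<Sum>n. \<integral>\<^sup>+u. ennreal (u powr (s + 1)) * indicator {0<..} u * I n u \<partial>lborel)"
    unfolding I_def by (intro suminf_cong Gamma_zeta_trapezoid_nn_integral(1)[OF s r(2)])
  also have "\<dots> = (\<integral>\<^sup>+u. (\<Sum>n. ennreal (u powr (s + 1)) * indicator {0<..} u * I n u) \<partial>lborel)"
    by (rule nn_integral_suminf[symmetric]) measurable
  also have "\<dots> = (\<integral>\<^sup>+u. (\<Sum>k. ennreal (2 * u powr s / (u^2 + (2 * pi * real (Suc k))^2)) * indicator {0<..} u) \<partial>lborel)"
  proof (intro nn_integral_cong)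
    fix u :: real
    show "(\<Sum>n. ennreal (u powr (s + 1)) * indicator {0<..} u * I n u) =
       (\<Sum>k. ennreal (2 * u powr s / (u^2 + (2 * pi * real (Suc k))^2)) * indicator {0<..} u)"
    proof (cases "u > 0")
      case True
      have "(\<Sum>n. ennreal (u powr (s + 1)) * indicator {0<..} u * I n u) = ennreal (u powr (s + 1)) * (\<Sum>n. I n u)"
        using True by (simp add: ennreal_suminf_cmult)
      also have "\<dots> = ennreal (u powr (s + 1)) * ennreal (bose_kernel u / u^2)"
        unfolding I_def suminf_trapezoid_kernel[OF True] ..
      also have "\<dots> = ennreal (u powr (s - 1) * bose_kernel u)"
        using True by (simp add: ennreal_mult'[symmetric] powr_add powr_diff power2_eq_square)
      also have "\<dots> = (\<Sum>k. ennreal (u powr (s - 1) * (2 * u / (u^2 + (2 * pi * real (Suc k))^2))))"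
        using True by (intro suminf_ennreal_eq[symmetric] sums_mult bose_kernel_sums) auto
      also have "(\<lambda>k. u powr (s - 1) * (2 * u / (u^2 + (2 * pi * real (Suc k))^2))) = (\<lambda>k. 2 * u powr s / (u^2 + (2 * pi * real (Suc k))^2))"
        using True by (simp add: powr_diff mult.commute)
      finally show ?thesis using True by simp
    qed simp
  qed
  also have "\<dots> = (\<Sum>k. \<integral>\<^sup>+u. ennreal (2 * u powr s / (u^2 + (2 * pi * real (Suc k))^2)) * indicator {0<..} u \<partial>lborel)"
    by (rule nn_integral_suminf) measurable
  also have "\<dots> = (\<Sum>k. ennreal ((2 * pi * real (Suc k)) powr (s - 1) * K))"
    unfolding K_def using s by (intro suminf_cong nn_integral_powr_over_square_plus_square) auto
  also have "(\<lambda>k. (2 * pi * real (Suc k)) powr (s - 1) * K) = (\<lambda>k. (2 * pi) powr (s - 1) * K * a k)"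
    unfolding a_def by (simp add: powr_mult mult_ac del: of_nat_Suc)
  also have "(\<Sum>k. ennreal ((2 * pi) powr (s - 1) * K * a k)) = ennreal ((2 * pi) powr (s - 1) * K * Q)"
    using K by (intro suminf_ennreal_eq sums_mult aQ) (auto simp: a_def)
  finally have "Gamma s * R = (2 * pi) powr (s - 1) * K * Q"
    using GR K \<open>Q \<ge> 0\<close> by (simp add: ennreal_inj)
  hence "Q = 2 * (2 * pi) powr (-s) * cos (pi * s / 2) * Gamma s * R"
    using cos by (simp add: K_def powr_diff powr_minus field_simps)
  hence "complex_of_real Q = complex_of_real (2 * (2 * pi) powr (-s) * cos (pi * s / 2) * Gamma s) * of_real R"
    by simp
  also have "complex_of_real (2 * (2 * pi) powr (-s) * cos (pi * s / 2) * Gamma s) = chi_factor (of_real s)"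
  proof -
    have "complex_of_real (2 * pi) powr (- of_real s) = of_real ((2 * pi) powr (- s))"
      by (subst powr_of_real[symmetric]) auto
    moreover have "cos (of_real pi * of_real s / 2) = complex_of_real (cos (pi * s / 2))"
      by (simp flip: cos_of_real)
    ultimately show ?thesis unfolding chi_factor_def by (simp add: Gamma_complex_of_real)
  qed
  finally show ?thesis by (simp only: R Q)
qed

section \<open>Extension to the strip and to the whole plane\<close>

lemma nonpos_Int_Re_gt_neg1:
  assumes "z \<in> \<int>\<^sub>\<le>\<^sub>0" "Re z > -1"
  shows "z = 0"
proof -
  obtain k where "z = - of_nat k" using assms(1) by (rule nonpos_Ints_cases')
  with assms(2) show ?thesis by (cases k) auto
qed

text \<open>The strip is symmetric under \<open>s \<mapsto> 1 - s\<close> and remains connected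
  without the points 0 and 1. The equation is known on the real interval \<open>U\<close>, which
  accumulates at \<open>-1/2\<close>, so the identity theorem applies.\<close>

lemma zeta_right_functional_equation:
  fixes s :: complex
  assumes s: "-1 < Re s" "Re s < 2" "s \<noteq> 0" "s \<noteq> 1"
  shows "zeta_right (1 - s) = chi_factor s * zeta_right s"
proof -
  define V where "V = {s. Re s > -1} \<inter> {s. Re s < 2}"
  define S where "S = V - {0, 1}"
  define U where "U = complex_of_real ` {-1<..<0}"
  have openV: "open V" unfolding V_def by (intro open_Int open_halfspace_Re_gt open_halfspace_Re_lt)
  have "connected V" unfolding V_def by (intro convex_connected convex_Int convex_halfspace_Re_gt convex_halfspace_Re_lt)
  hence connS: "connected S" unfolding S_def using openV by (intro connected_open_diff_countable) auto
  have openS: "open S" unfolding S_def using openV by (intro open_Diff) auto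
  have "zeta_right (1 - s) - chi_factor s * zeta_right s = 0"
  proof (rule analytic_continuation[where S = S and U = U and \<xi> = "-1/2" and f = "\<lambda>s. zeta_right (1 - s) - chi_factor s * zeta_right s"])
    have "S \<inter> \<int>\<^sub>\<le>\<^sub>0 = {}" using nonpos_Int_Re_gt_neg1 by (auto simp: S_def V_def)
    hence "chi_factor holomorphic_on S" by (rule holomorphic_chi_factor)
    moreover have "zeta_right holomorphic_on S"
      by (rule holomorphic_on_subset[OF holomorphic_zeta_right]) (auto simp: S_def V_def)
    moreover have "(zeta_right \<circ> (\<lambda>s. 1 - s)) holomorphic_on S"
      by (rule holomorphic_on_compose_gen[OF _ holomorphic_zeta_right]) (auto intro!: holomorphic_intros simp: S_def V_def)
    ultimately show "(\<lambda>s. zeta_right (1 - s) - chi_factor s * zeta_right s) holomorphic_on S"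
      by (auto intro!: holomorphic_intros simp: o_def)
    show "U \<subseteq> S" by (auto simp: U_def S_def V_def)
    show "-1/2 \<in> S" by (auto simp: S_def V_def complex_eq_iff)
    show "-1/2 islimpt U"
      unfolding islimpt_approachable
    proof (intro allI impI)
      fix e :: real assume e: "e > 0"
      define h where "h = min (e / 2) (1 / 4)"
      have h: "0 < h" "h < e" "h \<le> 1 / 4" using e by (auto simp: h_def)
      have eq: "complex_of_real (-1/2 + h) - (-1/2) = of_real h" by simp
      have "dist (complex_of_real (-1/2 + h)) (-1/2) < e"
        unfolding dist_norm eq using h by simp
      moreover have "complex_of_real (-1/2 + h) \<noteq> -1/2" using h eq by (metis diff_self of_real_eq_0_iff less_irrefl)
      moreover have "complex_of_real (-1/2 + h) \<in> U" using h unfolding U_def by (intro imageI) auto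
      ultimately show "\<exists>x'\<in>U. x' \<noteq> -1/2 \<and> dist x' (-1/2) < e" by blast
    qed
    show "zeta_right (1 - z) - chi_factor z * zeta_right z = 0" if "z \<in> U" for z
      using that zeta_right_functional_equation_real by (auto simp: U_def)
    show "s \<in> S" using s by (auto simp: S_def V_def)
  qed (rule openS connS)+
  thus ?thesis by simp
qed

definition zeta_glued :: "complex \<Rightarrow> complex" where
  "zeta_glued s = (if s = 1 then 0 else if Re s > -1 then zeta_right s
     else chi_factor (1 - s) * zeta_right (1 - s))"

text \<open>The open sets \<open>?A\<close> and \<open>?B\<close> cover the plane without 1. On
  their overlap \<open>-1 < Re s < 0\<close> the two formulas agree by the functional equation at
  \<open>1 - s\<close>, so holomorphy on each set suffices.\<close>

lemma is_zeta_glued: "is_zeta zeta_glued"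
  unfolding is_zeta_def
proof (intro conjI allI impI)
  let ?A = "{s. Re s > -1} - {1::complex}" and ?B = "{s::complex. Re s < 0}"
  have "zeta_glued holomorphic_on ?A"
    by (rule holomorphic_transform[OF holomorphic_zeta_right]) (auto simp: zeta_glued_def)
  moreover have "zeta_glued holomorphic_on ?B"
  proof (rule holomorphic_transform)
    have "((\<lambda>s. chi_factor s * zeta_right s) \<circ> (\<lambda>s. 1 - s)) holomorphic_on ?B"
    proof (rule holomorphic_on_compose_gen)
      have "z \<notin> \<int>\<^sub>\<le>\<^sub>0" if "Re z > 1" for z :: complex
        using nonpos_Int_Re_gt_neg1[of z] that by auto
      hence "{s. Re s > 1} \<inter> \<int>\<^sub>\<le>\<^sub>0 = {}" by blast
      hence "chi_factor holomorphic_on {s. Re s > 1}" by (rule holomorphic_chi_factor)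
      moreover have "zeta_right holomorphic_on {s. Re s > 1}"
        by (rule holomorphic_on_subset[OF holomorphic_zeta_right]) auto
      ultimately show "(\<lambda>s. chi_factor s * zeta_right s) holomorphic_on {s. Re s > 1}"
        by (intro holomorphic_intros)
    next
      show "(\<lambda>s. 1 - s) holomorphic_on ?B" by (intro holomorphic_intros)
    qed auto
    thus "(\<lambda>s. chi_factor (1 - s) * zeta_right (1 - s)) holomorphic_on ?B" by (simp add: o_def)
    fix s :: complex assume s: "s \<in> ?B"
    moreover have "s \<noteq> 0" using s by auto
    ultimately show "chi_factor (1 - s) * zeta_right (1 - s) = zeta_glued s"
      using zeta_right_functional_equation[of "1 - s"] by (auto simp: zeta_glued_def)
  qed
  moreover have "open ?A" "open ?B" by (rule open_halfplane_punctured open_halfspace_Re_lt)+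
  moreover have "- {1} = ?A \<union> ?B" by auto
  ultimately show "zeta_glued holomorphic_on (- {1})"
    by (simp only: holomorphic_on_Un)
next
  fix s :: complex assume "Re s > 1"
  thus "(\<lambda>n. of_nat (Suc n) powr (- s)) sums zeta_glued s"
    using zeta_right_series[of s] by (auto simp: zeta_glued_def)
qed (simp add: zeta_glued_def)

lemma riemann_zeta_eq_glued: "riemann_zeta = zeta_glued"
  unfolding riemann_zeta_def
  by (rule the_equality[where P = is_zeta, OF is_zeta_glued is_zeta_unique[OF _ is_zeta_glued]])

lemma riemann_zeta_functional_equation:
  assumes "Re s > -1" "s \<noteq> 0" "s \<noteq> 1"
  shows "riemann_zeta (1 - s) = chi_factor s * riemann_zeta s"
proof (cases "Re s < 2")
  case True
  with assms show ?thesis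
    using zeta_right_functional_equation[of s] by (simp add: riemann_zeta_eq_glued zeta_glued_def)
next
  case False
  \<comment> \<open>Here \<open>Re (1 - s) \<le> -1\<close>, where the equation is the defining
    formula of \<open>zeta_glued\<close>.\<close>
  with assms show ?thesis by (simp add: riemann_zeta_eq_glued zeta_glued_def)
qed

theorem theorem1:
  fixes s :: complex
  assumes "Re s > 1 / 2"
    and "\<bar>Im s\<bar> \<ge> 6.29073"
    and "riemann_zeta s \<noteq> 0"
  shows "norm (riemann_zeta (1 - s)) > norm (riemann_zeta s)"
proof -
  have "s \<noteq> 0" "s \<noteq> 1" using assms by auto
  hence "norm (riemann_zeta (1 - s)) = norm (chi_factor s) * norm (riemann_zeta s)"
    using assms by (subst riemann_zeta_functional_equation) (auto simp: norm_mult)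
  moreover have "norm (chi_factor s) > 1"
    using assms by (intro norm_chi_factor_gt_1)
  ultimately show ?thesis using assms(3) by simp
qed

end
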